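(* Let $K$ be a field, $S=K[x_1,\ldots,x_n]$ the polynomial algebra in $n$ variables over $K$, and let $I\supsetneq J$ be two squarefree monomial ideals of $S$. Let $d$ be a positive integer, and suppose that $I$ is minimally generated by a squarefree monomial $f$ of degree $d$ and a (possibly empty) set $E$ of squarefree monomials of degrees $\geq d+1$. Let $s$ be the number of squarefree monomials of degree $d+1$ in $I\setminus J$, and let $q$ be the number of squarefree monomials of degree $d+2$ in $I\setminus J$. Assume that $s\neq q+1$ and that $\operatorname{sdepth}_S I/J=d+1$. Then $\operatorname{depth}_S I/J\leq d+1$.
   Context: A squarefree monomial ideal is an ideal generated by squarefree monomials (the zero ideal is allowed). $\operatorname{depth}_S I/J$ is the usual depth of the graded $S$-module $I/J$ with respect to the graded maximal ideal $(x_1,\ldots,x_n)$. Stanley depth: let $P_{I\setminus J}$ be the poset of all squarefree monomials of $I\setminus J$, ordered by divisibility. For $u,v\in P_{I\setminus J}$ with $u\mid v$, the interval $[u,v]$ is $\{w\in P_{I\setminus J}: u\mid w,\ w\mid v\}$. Let $\mathcal{P}$ be a partition of $P_{I\setminus J}$ into intervals, that is, a disjoint union $P_{I\setminus J}=\bigcup_i [u_i,v_i]$. Define $\operatorname{sdepth}\mathcal{P}=\min_i \deg v_i$. The Stanley depth of $I/J$ is $\operatorname{sdepth}_S I/J=\max_{\mathcal{P}}\operatorname{sdepth}\mathcal{P}$, where $\mathcal{P}$ runs over all partitions of $P_{I\setminus J}$ into intervals. *)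

theory Defs
  imports
    "HOL-Library.Poly_Mapping"
    "HOL-Library.Extended_Nat"
    "HOL-Library.Disjoint_Sets"
begin

text \<open>
  \<open>K[x\<^sub>1,\<dots>,x\<^sub>n]\<close> is the whole type \<open>('n::finite, 'k::field) mpolynomial\<close>, with \<open>n = CARD('n)\<close>.
  The order \<open>\<le>\<close> that the library defines on \<open>\<Rightarrow>\<^sub>0\<close> is lexicographic and is not used here;
  divisibility of monomials is \<open>dvd\<close> in the polynomial ring.
\<close>

type_synonym ('n, 'k) mpolynomial = "('n \<Rightarrow>\<^sub>0 nat) \<Rightarrow>\<^sub>0 'k"

definition indet :: "'n \<Rightarrow> ('n, 'k::field) mpolynomial" where
  "indet i = Poly_Mapping.single (Poly_Mapping.single i 1) 1"

definition total_deg :: "('n::finite, 'k::field) mpolynomial \<Rightarrow> nat" where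
  "total_deg p = Max (insert 0 ((\<lambda>t. \<Sum>i\<in>UNIV. Poly_Mapping.lookup t i) ` Poly_Mapping.keys p))"

definition sqfree_monomials :: "('n, 'k::field) mpolynomial set" where
  "sqfree_monomials = {Poly_Mapping.single t 1 | t. \<forall>i. Poly_Mapping.lookup t i \<le> 1}"

subsection \<open>Ideals\<close>

lemma module_times: "module ((*) :: 'a::comm_ring_1 \<Rightarrow> 'a \<Rightarrow> 'a)"
  by unfold_locales (simp_all add: algebra_simps)

definition ideal_gen :: "'a::comm_ring_1 set \<Rightarrow> 'a set" where
  "ideal_gen G = module.span (*) G"

definition minimally_generates :: "'a::comm_ring_1 set \<Rightarrow> 'a set \<Rightarrow> bool" where
  "minimally_generates G I \<longleftrightarrow> ideal_gen G = I \<and> (\<forall>G'. G' \<subset> G \<longrightarrow> ideal_gen G' \<noteq> I)"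

definition sqfree_monomial_ideal :: "('n, 'k::field) mpolynomial set \<Rightarrow> bool" where
  "sqfree_monomial_ideal I \<longleftrightarrow> (\<exists>G \<subseteq> sqfree_monomials. I = ideal_gen G)"

definition max_graded_ideal :: "('n, 'k::field) mpolynomial set" where
  "max_graded_ideal = ideal_gen (range indet)"

subsection \<open>Depth\<close>

text \<open>
  For ideals \<open>J \<subseteq> I\<close>, submodules of \<open>I/J\<close> are represented by ideals between \<open>J\<close> and \<open>I\<close>:
  \<open>quot_sub I J Y\<close> is \<open>J + Y I\<close>, the preimage in \<open>I\<close> of the submodule \<open>Y (I/J)\<close>. So
  \<open>(I/J) / Y (I/J)\<close> is \<open>I / quot_sub I J Y\<close>, and the two conditions in \<open>regular_seq\<close>
  say that \<open>ys ! k\<close> is a nonzerodivisor on \<open>(I/J) / (ys ! 0, \<dots>, ys ! (k - 1)) (I/J)\<close>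
  and that \<open>(I/J) / (ys) (I/J)\<close> is nonzero.
\<close>

definition quot_sub :: "'a::comm_ring_1 set \<Rightarrow> 'a set \<Rightarrow> 'a set \<Rightarrow> 'a set" where
  "quot_sub I J Y = ideal_gen (J \<union> {y * a | y a. y \<in> Y \<and> a \<in> I})"

definition regular_seq :: "'a::comm_ring_1 set \<Rightarrow> 'a set \<Rightarrow> 'a list \<Rightarrow> bool" where
  "regular_seq I J ys \<longleftrightarrow>
     (\<forall>k < length ys. \<forall>a \<in> I.
        ys ! k * a \<in> quot_sub I J (set (take k ys)) \<longrightarrow> a \<in> quot_sub I J (set (take k ys))) \<and>
     quot_sub I J (set ys) \<noteq> I"

definition depth :: "('n, 'k::field) mpolynomial set \<Rightarrow> ('n, 'k) mpolynomial set \<Rightarrow> enat" where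
  "depth I J = (SUP ys \<in> {ys. set ys \<subseteq> max_graded_ideal \<and> regular_seq I J ys}. enat (length ys))"

subsection \<open>Stanley depth\<close>

definition sqfree_poset ::
    "('n, 'k::field) mpolynomial set \<Rightarrow> ('n, 'k) mpolynomial set \<Rightarrow> ('n, 'k) mpolynomial set" where
  "sqfree_poset I J = sqfree_monomials \<inter> (I - J)"

definition interval :: "'a::comm_ring_1 set \<Rightarrow> 'a \<Rightarrow> 'a \<Rightarrow> 'a set" where
  "interval P u v = {w \<in> P. u dvd w \<and> w dvd v}"

text \<open>
  A partition into intervals is given by the set of the pairs \<open>(u\<^sub>i, v\<^sub>i)\<close> of end points.
\<close>

definition interval_partitions :: "'a::comm_ring_1 set \<Rightarrow> ('a \<times> 'a) set set" where
  "interval_partitions P =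
     {Q. (\<forall>(u, v) \<in> Q. u \<in> P \<and> v \<in> P \<and> u dvd v) \<and>
         disjoint_family_on (\<lambda>(u, v). interval P u v) Q \<and>
         (\<Union>(u, v) \<in> Q. interval P u v) = P}"

definition sdepth_partition ::
    "(('n::finite, 'k::field) mpolynomial \<times> ('n, 'k) mpolynomial) set \<Rightarrow> nat" where
  "sdepth_partition Q = Min ((\<lambda>(u, v). total_deg v) ` Q)"

definition sdepth ::
    "('n::finite, 'k::field) mpolynomial set \<Rightarrow> ('n, 'k) mpolynomial set \<Rightarrow> nat" where
  "sdepth I J = Max (sdepth_partition ` interval_partitions (sqfree_poset I J))"

text \<open>The minimum and the maximum range over finite sets.\<close>

lemma finite_sqfree_monomials: "finite (sqfree_monomials :: ('n::finite, 'k::field) mpolynomial set)"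
proof -
  have "inj_on Poly_Mapping.lookup {t :: 'n \<Rightarrow>\<^sub>0 nat. \<forall>i. Poly_Mapping.lookup t i \<le> 1}"
    by (auto intro: inj_onI poly_mapping_eqI)
  moreover have "Poly_Mapping.lookup ` {t :: 'n \<Rightarrow>\<^sub>0 nat. \<forall>i. Poly_Mapping.lookup t i \<le> 1}
      \<subseteq> {g. \<forall>i. (i \<in> UNIV \<longrightarrow> g i \<in> {..1}) \<and> (i \<notin> UNIV \<longrightarrow> g i = 0)}"
    by auto
  moreover have "finite {g :: 'n \<Rightarrow> nat. \<forall>i. (i \<in> UNIV \<longrightarrow> g i \<in> {..1}) \<and> (i \<notin> UNIV \<longrightarrow> g i = 0)}"
    by (rule finite_set_of_finite_funs) auto
  ultimately have "finite {t :: 'n \<Rightarrow>\<^sub>0 nat. \<forall>i. Poly_Mapping.lookup t i \<le> 1}"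
    by (meson finite_imageD finite_subset)
  then show ?thesis
    by (simp add: sqfree_monomials_def setcompr_eq_image)
qed

lemma finite_interval_partitions:
  fixes P :: "('n::finite, 'k::field) mpolynomial set"
  assumes "P \<subseteq> sqfree_monomials"
  shows "finite (interval_partitions P)" "Q \<in> interval_partitions P \<Longrightarrow> finite Q"
proof -
  have P: "finite P"
    using assms finite_sqfree_monomials finite_subset by blast
  have "interval_partitions P \<subseteq> Pow (P \<times> P)"
    by (auto simp: interval_partitions_def)
  with P show "finite (interval_partitions P)" "Q \<in> interval_partitions P \<Longrightarrow> finite Q"
    by (meson finite_Pow_iff finite_SigmaI finite_subset PowD subsetD)+
qed

end

theory Submission
  imports Defs "HOL-Library.Countable"
begin

text \<open>
  Write \<open>P\<close> for the family of supports of the squarefree monomials in \<open>I - J\<close>, let \<open>F\<close> be the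
  support of \<open>f\<close>, and let \<open>B\<close> and \<open>C\<close> be the members of \<open>P\<close> of size \<open>d + 1\<close> and \<open>d + 2\<close>.
  Arguing by contradiction, a regular sequence of length at least \<open>d + 2\<close> is used to build an
  interval partition of \<open>P\<close> all of whose upper ends have degree at least \<open>d + 2\<close>.

  \<^emph>\<open>Algebra.\<close> A regular sequence in the maximal ideal makes the Koszul cohomology of \<open>I / J\<close>
  vanish below its length (\<open>koszul_exact\<close>). A cochain that carries a multiple of the monomial with
  support \<open>T\<close> at each \<open>T\<close> is nothing but a function on \<open>P\<close>, and on such cochains the
  differential is the signed incidence map between consecutive sizes. Since \<open>F\<close> is the only
  member of \<open>I\<close> of size at most \<open>d\<close>, exactness in degree \<open>d + 1\<close> says that a function on \<open>B\<close> which
  is killed by the map to functions on \<open>C\<close> is a scalar multiple of the image of \<open>F\<close>; unless it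
  is zero, it is then nonzero on all of \<open>V = {b \<in> B. F \<subseteq> b}\<close> (\<open>cocycle_support\<close>). Counting
  equations and unknowns, every subset of \<open>B\<close> that does not contain \<open>V\<close> has at least as many
  neighbours in \<open>C\<close> as elements (\<open>hall_condition\<close>). A second use of exactness shows that \<open>V\<close> has
  at least two elements when \<open>F \<in> P\<close> (\<open>F_extends\<close>).

  \<^emph>\<open>Combinatorics.\<close> If \<open>F \<notin> P\<close> then Hall's condition holds without exception, and a matching
  \<open>\<nu>\<close> of \<open>B\<close> into \<open>C\<close> gives intervals \<open>[b, \<nu> b]\<close>. If \<open>F \<in> P\<close>, then the elements of \<open>C\<close> above \<open>F\<close>
  are the edges of a graph on \<open>V\<close>, and what is needed is an edge \<open>c\<close> with ends \<open>v\<close>, \<open>w\<close> such that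
  \<open>B - {v, w}\<close> can be matched into \<open>C - {c}\<close>: the intervals are then \<open>[F, c] = {F, v, w, c}\<close> and the
  \<open>[b, \<nu> b]\<close>. Such an edge is found by \<open>matching_contract_edge\<close>: match all of \<open>B\<close> but one
  element of \<open>V\<close>, follow alternating paths from that element, and take the edge that is matched to
  the farthest element of \<open>V\<close>. In both cases what is left of \<open>P\<close> has degree at least \<open>d + 2\<close>
  and is covered by one-element intervals.
\<close>

section \<open>Alternating paths and matchings\<close>

definition matching :: "('a \<Rightarrow> 'b set) \<Rightarrow> 'a set \<Rightarrow> ('a \<Rightarrow> 'b) \<Rightarrow> bool" where
  "matching N A \<mu> \<longleftrightarrow> inj_on \<mu> A \<and> (\<forall>a\<in>A. \<mu> a \<in> N a)"

lemma matching_subset: "matching N A \<mu> \<Longrightarrow> A' \<subseteq> A \<Longrightarrow> matching N A' \<mu>"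
  by (auto simp: matching_def intro: inj_on_subset)

lemma matching_upd:
  assumes "matching N (A - {x}) \<mu>" "c \<in> N x" "c \<notin> \<mu> ` (A - {x})"
  shows "matching N A (\<mu>(x := c))"
proof -
  have "inj_on (\<mu>(x := c)) (insert x (A - {x}))"
    using assms by (auto simp: matching_def inj_on_def)
  then have "inj_on (\<mu>(x := c)) A"
    by (rule inj_on_subset) auto
  with assms show ?thesis
    by (auto simp: matching_def)
qed

text \<open>
  If \<open>\<mu>\<close> matches \<open>A - {v}\<close>, these are the vertices of \<open>A\<close> that an alternating path from the free
  vertex \<open>v\<close> reaches in at most \<open>k\<close> double steps.
\<close>

fun layer :: "('a \<Rightarrow> 'b set) \<Rightarrow> 'a set \<Rightarrow> ('a \<Rightarrow> 'b) \<Rightarrow> 'a \<Rightarrow> nat \<Rightarrow> 'a set" where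
  "layer N A \<mu> v 0 = {v}"
| "layer N A \<mu> v (Suc k) =
     layer N A \<mu> v k \<union> {y \<in> A - {v}. \<exists>z \<in> layer N A \<mu> v k. \<mu> y \<in> N z}"

lemma layer_subset: "v \<in> A \<Longrightarrow> layer N A \<mu> v k \<subseteq> A"
  by (induction k) auto

lemma layer_mono: "j \<le> k \<Longrightarrow> layer N A \<mu> v j \<subseteq> layer N A \<mu> v k"
  by (rule lift_Suc_mono_le[of "layer N A \<mu> v"]) auto

text \<open>
  Exchanging the edges along an alternating path moves the free vertex from \<open>v\<close> to the end \<open>x\<close> of
  the path. A shortest path meets only earlier layers before \<open>x\<close>, so the partners of all vertices
  that are at least as far away as \<open>x\<close> survive.
\<close>

lemma shift_matching:
  assumes \<mu>: "matching N (A - {v}) \<mu>" and "v \<in> A" and "x \<in> layer N A \<mu> v k"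
  shows "\<exists>\<nu>. matching N (A - {x}) \<nu> \<and> \<nu> ` (A - {x}) \<subseteq> \<mu> ` (A - {v}) \<and>
           (\<forall>a \<in> A - {x}. (\<forall>j<k. a \<notin> layer N A \<mu> v j) \<longrightarrow> \<nu> a = \<mu> a)"
  using assms(3)
proof (induction k arbitrary: x)
  case 0
  then show ?case
    using \<mu> by auto
next
  case (Suc k)
  show ?case
  proof (cases "x \<in> layer N A \<mu> v k")
    case True
    from Suc.IH[OF this] show ?thesis
      by (meson less_SucI)
  next
    case False
    then obtain z where x: "x \<in> A" "x \<noteq> v" and z: "z \<in> layer N A \<mu> v k" "\<mu> x \<in> N z"
      using Suc.prems by auto
    obtain \<nu> where \<nu>: "matching N (A - {z}) \<nu>" "\<nu> ` (A - {z}) \<subseteq> \<mu> ` (A - {v})"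
      and agree: "\<And>a. a \<in> A - {z} \<Longrightarrow> \<forall>j<k. a \<notin> layer N A \<mu> v j \<Longrightarrow> \<nu> a = \<mu> a"
      using Suc.IH[OF z(1)] by blast
    have zA: "z \<in> A"
      using z(1) layer_subset[OF \<open>v \<in> A\<close>] by blast
    have "z \<noteq> x"
      using False z(1) by auto
    have "\<forall>j<k. x \<notin> layer N A \<mu> v j"
      using False layer_mono[of _ k N A \<mu> v] by (meson less_imp_le subsetD)
    then have \<nu>x: "\<nu> x = \<mu> x"
      using agree x \<open>z \<noteq> x\<close> by auto
    \<comment> \<open>The partner of \<open>x\<close> passes to \<open>z\<close>, so that \<open>x\<close> becomes the free vertex.\<close>
    let ?\<nu> = "\<nu>(z := \<mu> x)"
    have sub: "(A - {x}) - {z} \<subseteq> A - {z}"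
      by auto
    have "\<nu> x \<notin> \<nu> ` ((A - {x}) - {z})"
      using \<nu>(1) x(1) \<open>z \<noteq> x\<close> by (auto simp: matching_def dest: inj_onD)
    then have "matching N (A - {x}) ?\<nu>"
      using matching_upd[OF matching_subset[OF \<nu>(1) sub] z(2)] \<nu>x by simp
    moreover have "?\<nu> ` (A - {x}) \<subseteq> \<mu> ` (A - {v})"
      using \<nu>(2) x by auto
    moreover have "\<forall>a \<in> A - {x}. (\<forall>j<Suc k. a \<notin> layer N A \<mu> v j) \<longrightarrow> ?\<nu> a = \<mu> a"
      using agree z(1) by (auto simp: less_Suc_eq)
    ultimately show ?thesis
      by blast
  qed
qed

text \<open>
  An unmatched neighbour of a reachable vertex would allow an augmentation. Hence all neighbours of
  the reachable set are partners of its vertices other than \<open>v\<close>.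
\<close>

lemma layers_deficient:
  assumes "finite A" and "v \<in> A" and \<mu>: "matching N (A - {v}) \<mu>"
    and none: "\<not> (\<exists>\<nu>. matching N A \<nu>)"
  defines "Y \<equiv> \<Union>k. layer N A \<mu> v k"
  shows "card (\<Union>(N ` Y)) < card Y"
proof -
  have YA: "Y \<subseteq> A"
    using layer_subset[OF \<open>v \<in> A\<close>] by (auto simp: Y_def)
  have vY: "v \<in> Y"
    unfolding Y_def by (rule UN_I[of 0]) auto
  have finY: "finite Y"
    using YA \<open>finite A\<close> finite_subset by blast
  have "\<Union>(N ` Y) \<subseteq> \<mu> ` (Y - {v})"
  proof
    fix c assume "c \<in> \<Union>(N ` Y)"
    then obtain z k where z: "z \<in> layer N A \<mu> v k" "c \<in> N z"
      by (auto simp: Y_def)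
    obtain \<nu> where \<nu>: "matching N (A - {z}) \<nu>" "\<nu> ` (A - {z}) \<subseteq> \<mu> ` (A - {v})"
      using shift_matching[OF \<mu> \<open>v \<in> A\<close> z(1)] by blast
    have "c \<in> \<mu> ` (A - {v})"
      using matching_upd[OF \<nu>(1) z(2)] \<nu>(2) none by blast
    then obtain y where y: "y \<in> A - {v}" "c = \<mu> y"
      by blast
    then have "y \<in> layer N A \<mu> v (Suc k)"
      using z by auto
    then have "y \<in> Y"
      unfolding Y_def by blast
    with y show "c \<in> \<mu> ` (Y - {v})"
      by blast
  qed
  then have "card (\<Union>(N ` Y)) \<le> card (Y - {v})"
    using finY by (meson card_image_le card_mono finite_Diff finite_imageI le_trans)
  also have "\<dots> < card Y"
    using vY finY by (rule card_Diff1_less[rotated])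
  finally show ?thesis .
qed

theorem hall_marriage:
  assumes "finite A" and "\<And>Y. Y \<subseteq> A \<Longrightarrow> card Y \<le> card (\<Union>(N ` Y))"
  shows "\<exists>\<mu>. matching N A \<mu>"
  using assms
proof (induction A rule: finite_induct)
  case empty
  then show ?case
    by (simp add: matching_def)
next
  case (insert v A)
  have "\<exists>\<mu>. matching N A \<mu>"
    using insert.prems by (intro insert.IH) blast
  then obtain \<mu> where "matching N A \<mu>" ..
  then have \<mu>: "matching N (insert v A - {v}) \<mu>"
    using insert.hyps by simp
  have "(\<Union>k. layer N (insert v A) \<mu> v k) \<subseteq> insert v A"
    by (intro UN_least layer_subset) simp
  from insert.prems[OF this] show ?case
    using layers_deficient[OF _ _ \<mu>] insert.hyps(1) by (meson finite_insert insertI1 not_less)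
qed

text \<open>
  The elements of the \<open>N v\<close> with \<open>v \<in> V\<close> play the role of edges with both ends in \<open>V\<close>. When Hall's
  condition is assumed only for sets that do not contain \<open>V\<close>, one element of \<open>A\<close> may have to stay
  unmatched; contracting a suitable edge within \<open>V\<close> repairs this. If no matching of \<open>A\<close> exists, the
  set reachable from a free \<open>v\<^sub>0 \<in> V\<close> is deficient and therefore contains \<open>V\<close>, which makes distances
  from \<open>v\<^sub>0\<close> available on \<open>V\<close>.
\<close>

theorem matching_contract_edge:
  assumes "finite A" and "V \<subseteq> A" and "v\<^sub>0 \<in> V" and "v\<^sub>1 \<in> V" and "v\<^sub>0 \<noteq> v\<^sub>1"
    and hall: "\<And>Y. Y \<subseteq> A \<Longrightarrow> \<not> V \<subseteq> Y \<Longrightarrow> card Y \<le> card (\<Union>(N ` Y))"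
    and edge: "\<And>v c. v \<in> V \<Longrightarrow> c \<in> N v \<Longrightarrow> \<exists>w \<in> V. w \<noteq> v \<and> c \<in> N w"
  shows "\<exists>v w c \<nu>. v \<in> V \<and> w \<in> V \<and> v \<noteq> w \<and> c \<in> N v \<and> c \<in> N w \<and>
           matching (\<lambda>a. N a - {c}) (A - {v, w}) \<nu>"
proof -
  \<comment> \<open>It is enough to match everything but \<open>w\<close> so that \<open>v\<close> gets the edge \<open>vw\<close>.\<close>
  have suff: ?thesis if \<nu>: "matching N (A - {w}) \<nu>" and "v \<in> V" "w \<in> V" "v \<noteq> w" "\<nu> v \<in> N w" for \<nu> v w
  proof -
    have v: "v \<in> A - {w}"
      using that \<open>V \<subseteq> A\<close> by auto
    have "matching (\<lambda>a. N a - {\<nu> v}) (A - {v, w}) \<nu>"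
      using \<nu> v by (fastforce simp: matching_def inj_on_def)
    moreover have "\<nu> v \<in> N v"
      using \<nu> v by (auto simp: matching_def)
    ultimately show ?thesis
      using that by blast
  qed
  show ?thesis
  proof (cases "\<exists>\<nu>. matching N A \<nu>")
    case True
    then obtain \<nu> where \<nu>: "matching N A \<nu>" ..
    then have "\<nu> v\<^sub>0 \<in> N v\<^sub>0"
      using \<open>v\<^sub>0 \<in> V\<close> \<open>V \<subseteq> A\<close> by (auto simp: matching_def)
    then obtain w where "w \<in> V" "w \<noteq> v\<^sub>0" "\<nu> v\<^sub>0 \<in> N w"
      using edge[OF \<open>v\<^sub>0 \<in> V\<close>] by blast
    then show ?thesis
      using suff[OF matching_subset[OF \<nu> Diff_subset] \<open>v\<^sub>0 \<in> V\<close>] by blast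
  next
    case False
    have "v\<^sub>0 \<in> A"
      using assms by auto
    have "\<exists>\<mu>. matching N (A - {v\<^sub>0}) \<mu>"
      using \<open>v\<^sub>0 \<in> V\<close> \<open>finite A\<close> by (intro hall_marriage hall) auto
    then obtain \<mu> where \<mu>: "matching N (A - {v\<^sub>0}) \<mu>" ..
    define L where "L = layer N A \<mu> v\<^sub>0"
    have "(\<Union>k. L k) \<subseteq> A"
      unfolding L_def by (intro UN_least layer_subset \<open>v\<^sub>0 \<in> A\<close>)
    from hall[OF this] have VL: "V \<subseteq> (\<Union>k. L k)"
      using layers_deficient[OF \<open>finite A\<close> \<open>v\<^sub>0 \<in> A\<close> \<mu> False, folded L_def] by linarith
    define rank where "rank a = (LEAST k. a \<in> L k)" for a
    have rank: "a \<in> L (rank a)" if "a \<in> V" for a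
      unfolding rank_def using VL that by (metis LeastI UN_E subsetD)
    have below: "a \<notin> L k" if "k < rank a" for a k
      using that unfolding rank_def by (rule not_less_Least)
    \<comment> \<open>Shifting along a shortest path to \<open>w\<close> cannot touch a vertex that is at least as
      far away, and the far end of the edge of a farthest vertex is of that kind.\<close>
    have "finite V"
      using \<open>finite A\<close> \<open>V \<subseteq> A\<close> finite_subset by blast
    then have "Max (rank ` V) \<in> rank ` V"
      using \<open>v\<^sub>0 \<in> V\<close> by (intro Max_in) auto
    then obtain v where v: "v \<in> V" "rank v = Max (rank ` V)"
      by (metis imageE)
    have max: "rank w \<le> rank v" if "w \<in> V" for w
      using that v(2) \<open>finite V\<close> by simp
    have "v \<noteq> v\<^sub>0"
    proof
      assume "v = v\<^sub>0"
      then have "rank v = 0"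
        by (simp add: rank_def L_def)
      then have "rank v\<^sub>1 = 0"
        using max[OF \<open>v\<^sub>1 \<in> V\<close>] by simp
      then show False
        using rank[OF \<open>v\<^sub>1 \<in> V\<close>] \<open>v\<^sub>0 \<noteq> v\<^sub>1\<close> by (simp add: L_def)
    qed
    then have "\<mu> v \<in> N v"
      using \<mu> v(1) \<open>V \<subseteq> A\<close> by (auto simp: matching_def)
    then obtain w where w: "w \<in> V" "w \<noteq> v" "\<mu> v \<in> N w"
      using edge[OF v(1)] by blast
    obtain \<nu> where \<nu>: "matching N (A - {w}) \<nu>"
      and agree: "\<forall>a \<in> A - {w}. (\<forall>j < rank w. a \<notin> L j) \<longrightarrow> \<nu> a = \<mu> a"
      using shift_matching[OF \<mu> \<open>v\<^sub>0 \<in> A\<close> rank[OF w(1), unfolded L_def]] unfolding L_def by blast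
    have "v \<in> A - {w}"
      using v(1) w(2) \<open>V \<subseteq> A\<close> by auto
    moreover have "\<forall>j < rank w. v \<notin> L j"
      using below max[OF w(1)] by (meson less_le_trans)
    ultimately have "\<nu> v = \<mu> v"
      using agree by blast
    then show ?thesis
      using suff[OF \<nu> v(1) w(1)] w by simp
  qed
qed

section \<open>Underdetermined linear systems\<close>

lemma underdetermined_system:
  fixes M :: "'c \<Rightarrow> 'b \<Rightarrow> 'k::field"
  assumes "finite C" and "finite X" and "card C < card X"
  shows "\<exists>a. (\<exists>x\<in>X. a x \<noteq> 0) \<and> (\<forall>c\<in>C. (\<Sum>x\<in>X. M c x * a x) = 0)"
  using assms
proof (induction C arbitrary: X M rule: finite_induct)
  case empty
  then have "X \<noteq> {}"
    by auto
  then show ?case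
    by (intro exI[of _ "\<lambda>_. 1"]) auto
next
  case (insert c C)
  have fin: "finite X"
    by (rule insert.prems)
  show ?case
  proof (cases "\<exists>p\<in>X. M c p \<noteq> 0")
    case False
    obtain a where "\<exists>x\<in>X. a x \<noteq> 0" "\<forall>e\<in>C. (\<Sum>x\<in>X. M e x * a x) = 0"
      using insert.IH[OF fin, of M] insert.prems insert.hyps by auto
    then show ?thesis
      using False by (intro exI[of _ a]) (auto intro: sum.neutral)
  next
    case True
    then obtain p where p: "p \<in> X" "M c p \<noteq> 0"
      by blast
    define M' where "M' e x = M e x - M e p * M c x / M c p" for e x
    have "card C < card (X - {p})"
      using insert.prems insert.hyps p(1) by (simp add: fin)
    then obtain a where a: "\<exists>x\<in>X-{p}. a x \<noteq> 0"
        "\<forall>e\<in>C. (\<Sum>x\<in>X-{p}. M' e x * a x) = 0"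
      using insert.IH[of "X - {p}" M'] fin by auto
    define t where "t = (\<Sum>x\<in>X-{p}. M c x * a x)"
    define b where "b = a(p := - t / M c p)"
    have b: "(\<Sum>x\<in>X. M e x * b x) = (\<Sum>x\<in>X-{p}. M e x * a x) - M e p * t / M c p" for e
      using p(1) fin by (simp add: sum.remove[of X p] b_def)
    have "(\<Sum>x\<in>X-{p}. M' e x * a x) = (\<Sum>x\<in>X-{p}. M e x * a x) - M e p * t / M c p" for e
      by (simp add: M'_def t_def left_diff_distrib sum_subtractf sum_distrib_left
          sum_divide_distrib mult.assoc)
    with a(2) b have "\<forall>e\<in>C. (\<Sum>x\<in>X. M e x * b x) = 0"
      by simp
    moreover have "(\<Sum>x\<in>X. M c x * b x) = 0"
      using b[of c] p(2) by (simp add: t_def)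
    moreover have "\<exists>x\<in>X. b x \<noteq> 0"
      using a(1) by (auto simp: b_def)
    ultimately show ?thesis
      by (intro exI[of _ b]) auto
  qed
qed

section \<open>The Koszul complex and regular sequences\<close>

interpretation ideal: module "(*) :: 'a::comm_ring_1 \<Rightarrow> 'a \<Rightarrow> 'a"
  by (rule module_times)

\<comment> \<open>As a rewrite rule, this reassociates products against \<open>mult.assoc\<close>.\<close>
declare ideal.scale_scale [simp del]

lemma quot_sub_mono: "Y \<subseteq> Y' \<Longrightarrow> quot_sub I J Y \<subseteq> quot_sub I J Y'"
  unfolding quot_sub_def ideal_gen_def by (intro ideal.span_mono) auto

lemma quot_sub_empty: "quot_sub I J {} = ideal_gen J"
  by (simp add: quot_sub_def)

lemma subspace_quot_sub: "ideal.subspace (quot_sub I J Y)"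
  unfolding quot_sub_def ideal_gen_def by simp

lemma mult_mem_quot_sub: "y \<in> Y \<Longrightarrow> a \<in> I \<Longrightarrow> y * a \<in> quot_sub I J Y"
  unfolding quot_sub_def ideal_gen_def by (intro ideal.span_base) auto

text \<open>
  Passing from \<open>Y\<close> to \<open>insert y Y\<close> divides the quotient of \<open>I\<close> by \<open>y\<close> times the image of \<open>I\<close>.
\<close>

lemma quot_sub_insertE:
  assumes "ideal.subspace I" and "p \<in> quot_sub I J (insert y Y)"
  obtains q a where "q \<in> quot_sub I J Y" "a \<in> I" "p = q + y * a"
proof -
  let ?Q = "quot_sub I J Y"
  let ?S = "{q + y * a | q a. q \<in> ?Q \<and> a \<in> I}"
  have Q: "ideal.subspace ?Q"
    by (rule subspace_quot_sub)
  have J: "J \<subseteq> ?Q"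
    unfolding quot_sub_def ideal_gen_def using ideal.span_superset by blast
  have sub: "ideal.subspace ?S"
  proof (rule ideal.subspaceI)
    show "0 \<in> ?S"
      using ideal.subspace_0[OF Q] ideal.subspace_0[OF assms(1)] by force
  next
    fix p p' assume "p \<in> ?S" "p' \<in> ?S"
    then obtain q a q' a' where "q \<in> ?Q" "a \<in> I" "p = q + y * a" "q' \<in> ?Q" "a' \<in> I" "p' = q' + y * a'"
      by blast
    then have "q + q' \<in> ?Q" "a + a' \<in> I" "p + p' = (q + q') + y * (a + a')"
      using ideal.subspace_add[OF Q] ideal.subspace_add[OF assms(1)]
      by (simp_all add: distrib_left add_ac)
    then show "p + p' \<in> ?S"
      by blast
  next
    fix c p assume "p \<in> ?S"
    then obtain q a where "q \<in> ?Q" "a \<in> I" "p = q + y * a"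
      by blast
    then have "c * q \<in> ?Q" "c * a \<in> I" "c * p = c * q + y * (c * a)"
      using ideal.subspace_scale[OF Q] ideal.subspace_scale[OF assms(1)]
      by (simp_all add: distrib_left mult.left_commute)
    then show "c * p \<in> ?S"
      by blast
  qed
  have "J \<union> {b * a | b a. b \<in> insert y Y \<and> a \<in> I} \<subseteq> ?S"
  proof
    fix p assume "p \<in> J \<union> {b * a | b a. b \<in> insert y Y \<and> a \<in> I}"
    then consider "p \<in> ?Q" | a where "a \<in> I" "p = y * a"
      using J mult_mem_quot_sub by blast
    then show "p \<in> ?S"
    proof cases
      case 1
      moreover have "p = p + y * 0"
        by simp
      ultimately show ?thesis
        using ideal.subspace_0[OF assms(1)] by blast
    next
      case 2
      moreover from this have "p = 0 + y * a"
        by simp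
      ultimately show ?thesis
        using ideal.subspace_0[OF Q] by blast
    qed
  qed
  then have "p \<in> ?S"
    using assms(2) ideal.span_minimal[OF _ sub] unfolding quot_sub_def ideal_gen_def by blast
  then show thesis
    using that by blast
qed

lemma ideal_gen_rangeE:
  fixes x :: "'n::finite \<Rightarrow> 'a::comm_ring_1"
  assumes "y \<in> ideal_gen (range x)"
  obtains c where "y = (\<Sum>j\<in>UNIV. c j * x j)"
proof -
  let ?S = "{\<Sum>j\<in>UNIV. c j * x j | c. True}"
  have "ideal.subspace ?S"
  proof (rule ideal.subspaceI)
    show "0 \<in> ?S"
      by (auto intro!: exI[of _ "\<lambda>_. 0"])
  next
    fix p q assume "p \<in> ?S" "q \<in> ?S"
    then obtain b c where "p = (\<Sum>j\<in>UNIV. b j * x j)" "q = (\<Sum>j\<in>UNIV. c j * x j)"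
      by blast
    then have "p + q = (\<Sum>j\<in>UNIV. (b j + c j) * x j)"
      by (simp add: algebra_simps sum.distrib)
    then show "p + q \<in> ?S"
      by (auto intro!: exI[of _ "\<lambda>j. b j + c j"])
  next
    fix r p assume "p \<in> ?S"
    then obtain c where "p = (\<Sum>j\<in>UNIV. c j * x j)"
      by blast
    then have "r * p = (\<Sum>j\<in>UNIV. (r * c j) * x j)"
      by (simp add: sum_distrib_left mult.assoc)
    then show "r * p \<in> ?S"
      by (auto intro!: exI[of _ "\<lambda>j. r * c j"])
  qed
  moreover have "range x \<subseteq> ?S"
  proof
    fix p assume "p \<in> range x"
    then obtain i where i: "p = x i"
      by blast
    have "(\<Sum>j\<in>UNIV. (if j = i then 1 else 0) * x j) = (\<Sum>j\<in>UNIV. if j = i then x j else 0)"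
      by (rule sum.cong) auto
    then have "p = (\<Sum>j\<in>UNIV. (if j = i then 1 else 0) * x j)"
      by (simp add: i)
    then show "p \<in> ?S"
      by (auto intro!: exI[of _ "\<lambda>j. if j = i then 1 else 0"])
  qed
  ultimately have "y \<in> ?S"
    using assms ideal.span_minimal unfolding ideal_gen_def by blast
  then show thesis
    using that by blast
qed

text \<open>
  The sign that moves \<open>e\<^sub>t\<close> into its place in the exterior product indexed by \<open>T\<close>, with respect to
  the order that \<open>to_nat\<close> induces on the index type. Both \<open>t \<in> T\<close> and \<open>t \<notin> T\<close> occur.
\<close>

definition kos_sign :: "'n::finite \<Rightarrow> 'n set \<Rightarrow> 'a::comm_ring_1" where
  "kos_sign t T = (- 1) ^ card {s \<in> T. to_nat s < to_nat t}"

lemma kos_sign_insert_self [simp]: "kos_sign t (insert t T) = kos_sign t T"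
proof -
  have "{s \<in> insert t T. to_nat s < to_nat t} = {s \<in> T. to_nat s < to_nat t}"
    by auto
  then show ?thesis
    by (simp add: kos_sign_def)
qed

lemma kos_sign_remove_self [simp]: "kos_sign t (T - {t}) = kos_sign t T"
proof -
  have "{s \<in> T - {t}. to_nat s < to_nat t} = {s \<in> T. to_nat s < to_nat t}"
    by auto
  then show ?thesis
    by (simp add: kos_sign_def)
qed

lemma kos_sign_square [simp]: "kos_sign t T * (kos_sign t T * c) = c"
  by (simp add: kos_sign_def)

lemma kos_sign_nonzero [simp]: "kos_sign t T \<noteq> (0 :: 'k::field)"
  by (simp add: kos_sign_def)

lemma kos_sign_insert:
  assumes "j \<notin> T"
  shows "kos_sign t (insert j T) = (if to_nat j < to_nat t then - kos_sign t T else kos_sign t T)"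
proof (cases "to_nat j < to_nat t")
  case True
  then have "{s \<in> insert j T. to_nat s < to_nat t} = insert j {s \<in> T. to_nat s < to_nat t}"
    by auto
  with True assms show ?thesis
    by (simp add: kos_sign_def)
next
  case False
  then have "{s \<in> insert j T. to_nat s < to_nat t} = {s \<in> T. to_nat s < to_nat t}"
    by auto
  with False show ?thesis
    by (simp add: kos_sign_def)
qed

lemma kos_sign_anticommute:
  assumes "s \<noteq> t" "s \<notin> T" "t \<notin> T"
  shows "kos_sign t T * kos_sign s (insert t T) = - (kos_sign s T * kos_sign t (insert s T))"
    and "kos_sign t T * kos_sign s T = - (kos_sign s (insert t T) * kos_sign t (insert s T))"
proof -
  have "to_nat s \<noteq> to_nat t"
    using assms(1) by simp
  then show "kos_sign t T * kos_sign s (insert t T) = - (kos_sign s T * kos_sign t (insert s T))"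
    and "kos_sign t T * kos_sign s T = - (kos_sign s (insert t T) * kos_sign t (insert s T))"
    using assms by (auto simp: kos_sign_insert mult.commute)
qed

text \<open>
  Cochains of degree \<open>i\<close> are functions on index sets of which only the values at sets of size \<open>i\<close>
  matter: \<open>z T\<close> is the coefficient of the exterior monomial \<open>e\<^sub>T\<close>. Then \<open>koszul x\<close> is exterior
  multiplication by the sum of all \<open>x\<^sub>t e\<^sub>t\<close>, and \<open>contract c\<close> is contraction with the linear form
  that sends \<open>e\<^sub>j\<close> to \<open>c\<^sub>j\<close>.
\<close>

definition koszul :: "('n::finite \<Rightarrow> 'a::comm_ring_1) \<Rightarrow> ('n set \<Rightarrow> 'a) \<Rightarrow> 'n set \<Rightarrow> 'a" where
  "koszul x z T = (\<Sum>t\<in>T. kos_sign t T * (x t * z (T - {t})))"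

definition contract :: "('n::finite \<Rightarrow> 'a::comm_ring_1) \<Rightarrow> ('n set \<Rightarrow> 'a) \<Rightarrow> 'n set \<Rightarrow> 'a" where
  "contract c z T = (\<Sum>j\<in>-T. kos_sign j T * (c j * z (insert j T)))"

lemma koszul_cong:
  assumes "card T = Suc i" and "\<And>T. card T = i \<Longrightarrow> z T = w T"
  shows "koszul x z T = koszul x w T"
  unfolding koszul_def using assms by (intro sum.cong refl) simp

lemma koszul_add: "koszul x (\<lambda>T. z T + w T) T = koszul x z T + koszul x w T"
  by (simp add: koszul_def distrib_left sum.distrib)

lemma koszul_mult: "koszul x (\<lambda>T. r * z T) T = r * koszul x z T"
  by (simp add: koszul_def sum_distrib_left mult.left_commute)

lemma koszul_mem:
  assumes "ideal.subspace Q" and "card T = Suc i" and "\<And>T. card T = i \<Longrightarrow> z T \<in> Q"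
  shows "koszul x z T \<in> Q"
  unfolding koszul_def using assms
  by (intro ideal.subspace_sum ideal.subspace_scale) auto

lemma contract_mem:
  assumes "ideal.subspace Q" and "card T = i" and "\<And>T. card T = Suc i \<Longrightarrow> z T \<in> Q"
  shows "contract c z T \<in> Q"
  unfolding contract_def using assms
  by (intro ideal.subspace_sum ideal.subspace_scale) auto

lemma sum_antisym_pairs:
  fixes g :: "'n \<Rightarrow> 'n \<Rightarrow> 'a::ab_group_add"
  assumes "finite T" and "\<And>s t. s \<in> T \<Longrightarrow> t \<in> T \<Longrightarrow> s \<noteq> t \<Longrightarrow> g s t = - g t s"
  shows "(\<Sum>t\<in>T. \<Sum>s\<in>T - {t}. g t s) = 0"
  using assms
proof (induction T rule: finite_induct)
  case (insert a T)
  have "(\<Sum>s\<in>insert a T - {t}. g t s) = g t a + (\<Sum>s\<in>T - {t}. g t s)" if "t \<in> T" for t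
  proof -
    have "insert a T - {t} = insert a (T - {t})"
      using that insert.hyps by auto
    then show ?thesis
      using insert.hyps by simp
  qed
  moreover have "insert a T - {a} = T"
    using insert.hyps by auto
  ultimately have "(\<Sum>t\<in>insert a T. \<Sum>s\<in>insert a T - {t}. g t s)
      = (\<Sum>s\<in>T. g a s) + ((\<Sum>t\<in>T. g t a) + (\<Sum>t\<in>T. \<Sum>s\<in>T - {t}. g t s))"
    using insert.hyps by (simp add: sum.distrib)
  also have "(\<Sum>t\<in>T. \<Sum>s\<in>T - {t}. g t s) = 0"
    using insert.prems by (intro insert.IH) blast
  also have "(\<Sum>s\<in>T. g a s) = - (\<Sum>t\<in>T. g t a)"
    using insert.prems insert.hyps(2) unfolding sum_negf[symmetric]
    by (intro sum.cong refl) blast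
  finally show ?case
    by simp
qed simp

lemma koszul_koszul:
  fixes x :: "'n::finite \<Rightarrow> 'a::comm_ring_1"
  shows "koszul x (koszul x z) T = 0"
proof -
  define g where "g t s = kos_sign t T * (x t * (kos_sign s (T - {t}) * (x s * z (T - {t} - {s}))))" for t s
  have "koszul x (koszul x z) T = (\<Sum>t\<in>T. \<Sum>s\<in>T - {t}. g t s)"
    by (simp add: koszul_def g_def sum_distrib_left)
  also have "\<dots> = 0"
  proof (rule sum_antisym_pairs)
    fix s t assume st: "s \<in> T" "t \<in> T" "s \<noteq> t"
    define U where "U = T - {s} - {t}"
    have T: "T - {t} - {s} = U" "T - {t} = insert s U" "T - {s} = insert t U" "s \<notin> U" "t \<notin> U"
      using st by (auto simp: U_def)
    have sgn: "kos_sign t T = (kos_sign t (insert s U) :: 'a)" "kos_sign s T = (kos_sign s (insert t U) :: 'a)"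
      using T(2,3) by (metis kos_sign_remove_self)+
    have "g s t = (kos_sign t U * kos_sign s (insert t U)) * (x s * (x t * z U))"
      unfolding g_def U_def[symmetric] T(3) sgn using T(5) by (simp add: mult_ac)
    also have "\<dots> = - ((kos_sign s U * kos_sign t (insert s U)) * (x s * (x t * z U)))"
      by (simp only: kos_sign_anticommute(1)[OF st(3) T(4,5)] mult_minus_left)
    also have "(kos_sign s U * kos_sign t (insert s U)) * (x s * (x t * z U)) = g t s"
      unfolding g_def T(1) unfolding T(2) sgn by (simp add: mult_ac)
    finally show "g s t = - g t s" .
  qed simp
  finally show ?thesis .
qed

text \<open>
  Cartan's formula: contraction is a homotopy from zero to multiplication by the linear combination
  of the \<open>x\<^sub>j\<close>, so every element of the ideal generated by the \<open>x\<^sub>j\<close> kills the Koszul cohomology.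
\<close>

lemma koszul_homotopy:
  fixes x :: "'n::finite \<Rightarrow> 'a::comm_ring_1"
  shows "koszul x (contract c z) T + contract c (koszul x z) T = (\<Sum>j\<in>UNIV. c j * x j) * z T"
proof -
  define e where "e t j = kos_sign t T * (x t * (kos_sign j (T - {t}) * (c j * z (insert j (T - {t})))))" for t j
  define e' where "e' t j = kos_sign j T * (c j * (kos_sign t (insert j T) * (x t * z (insert j T - {t}))))" for t j
  have cross: "e t j + e' t j = 0" if "t \<in> T" "j \<in> -T" for t j
  proof -
    define U where "U = T - {t}"
    have T: "T = insert t U" "t \<notin> U" "j \<notin> U" "j \<noteq> t" "insert j T - {t} = insert j U"
      using that by (auto simp: U_def)
    have "insert j T = insert t (insert j U)"
      using T by auto
    then have sgn: "kos_sign t (insert j T) = (kos_sign t (insert j U) :: 'a)"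
        "kos_sign t T = (kos_sign t U :: 'a)" "kos_sign j T = (kos_sign j (insert t U) :: 'a)"
      using T(1) by simp_all
    have "e t j = (kos_sign t U * kos_sign j U) * (x t * (c j * z (insert j U)))"
      unfolding e_def U_def[symmetric] sgn by (simp add: mult_ac)
    also have "\<dots> = - ((kos_sign j (insert t U) * kos_sign t (insert j U)) * (x t * (c j * z (insert j U))))"
      by (simp only: kos_sign_anticommute(2)[OF T(4,3,2)] mult_minus_left)
    also have "(kos_sign j (insert t U) * kos_sign t (insert j U)) * (x t * (c j * z (insert j U))) = e' t j"
      unfolding e'_def T(5) sgn by (simp add: mult_ac)
    finally show ?thesis
      by simp
  qed
  have compl: "- (T - {t}) = insert t (- T)" for t
    by auto
  have "koszul x (contract c z) T = (\<Sum>t\<in>T. \<Sum>j\<in>insert t (-T). e t j)"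
    by (simp only: koszul_def contract_def e_def sum_distrib_left compl)
  also have "\<dots> = (\<Sum>t\<in>T. e t t) + (\<Sum>t\<in>T. \<Sum>j\<in>-T. e t j)"
    by (simp add: sum.distrib)
  also have "(\<Sum>t\<in>T. e t t) = (\<Sum>t\<in>T. c t * x t) * z T"
    unfolding sum_distrib_right
    by (intro sum.cong refl) (simp add: e_def insert_absorb mult.left_commute[of "x _"] mult_ac(1))
  finally have 1: "koszul x (contract c z) T = (\<Sum>t\<in>T. c t * x t) * z T + (\<Sum>t\<in>T. \<Sum>j\<in>-T. e t j)" .
  have "contract c (koszul x z) T = (\<Sum>j\<in>-T. \<Sum>t\<in>insert j T. e' t j)"
    by (simp only: koszul_def contract_def e'_def sum_distrib_left)
  also have "\<dots> = (\<Sum>j\<in>-T. e' j j) + (\<Sum>j\<in>-T. \<Sum>t\<in>T. e' t j)"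
    by (simp add: sum.distrib)
  also have "(\<Sum>j\<in>-T. e' j j) = (\<Sum>j\<in>-T. c j * x j) * z T"
    unfolding sum_distrib_right
    by (intro sum.cong refl) (simp add: e'_def insert_absorb mult.left_commute[of "c _"] mult_ac(1))
  also have "(\<Sum>j\<in>-T. \<Sum>t\<in>T. e' t j) = (\<Sum>t\<in>T. \<Sum>j\<in>-T. e' t j)"
    by (rule sum.swap)
  finally have 2: "contract c (koszul x z) T = (\<Sum>j\<in>-T. c j * x j) * z T + (\<Sum>t\<in>T. \<Sum>j\<in>-T. e' t j)" .
  have "(\<Sum>t\<in>T. \<Sum>j\<in>-T. e t j) + (\<Sum>t\<in>T. \<Sum>j\<in>-T. e' t j) = 0"
    by (simp add: cross flip: sum.distrib)
  moreover have "(\<Sum>j\<in>UNIV. c j * x j) = (\<Sum>t\<in>T. c t * x t) + (\<Sum>j\<in>-T. c j * x j)"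
    by (simp add: sum.union_disjoint[symmetric])
  ultimately show ?thesis
    unfolding 1 2 by (simp add: algebra_simps)
qed

text \<open>
  Depth sensitivity of the Koszul complex, for all the intermediate quotients of \<open>I\<close> at once. Let
  \<open>z\<close> be a cocycle with values in the \<open>k\<close>-th quotient and let \<open>y\<close> be the next element of the sequence. By
  the homotopy, \<open>y z\<close> is the coboundary of some \<open>w\<close>, so \<open>w\<close> is a cocycle one degree lower modulo
  \<open>y\<close>. The induction hypothesis makes \<open>w\<close> a coboundary plus a multiple \<open>y u\<close>; hence \<open>y z\<close> equals
  \<open>y\<close> times the coboundary of \<open>u\<close>, and \<open>y\<close> is cancelled because it is a nonzerodivisor.
\<close>

theorem koszul_exact:
  fixes x :: "'n::finite \<Rightarrow> 'a::comm_ring_1"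
  assumes "ideal.subspace I" and ys: "set ys \<subseteq> ideal_gen (range x)" and reg: "regular_seq I J ys"
    and "k + i < length ys"
    and "\<And>T. card T = i \<Longrightarrow> z T \<in> I"
    and "\<And>T. card T = Suc i \<Longrightarrow> koszul x z T \<in> quot_sub I J (set (take k ys))"
  shows "\<exists>u. (\<forall>T. Suc (card T) = i \<longrightarrow> u T \<in> I) \<and>
           (\<forall>T. card T = i \<longrightarrow> z T - koszul x u T \<in> quot_sub I J (set (take k ys)))"
  using assms(4-)
proof (induction i arbitrary: k z)
  let ?Q = "\<lambda>k. quot_sub I J (set (take k ys))"
  note Q = subspace_quot_sub[of I J]
  have nzd: "a \<in> ?Q k" if "k < length ys" "a \<in> I" "ys ! k * a \<in> ?Q k" for k a
    using reg that unfolding regular_seq_def by blast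
  {
    case 0
    then have k: "k < length ys"
      by simp
    then obtain c where c: "ys ! k = (\<Sum>j\<in>UNIV. c j * x j)"
      using ideal_gen_rangeE[of "ys ! k" x] ys nth_mem by blast
    have "contract c (koszul x z) {} \<in> ?Q k"
      using 0 by (intro contract_mem[OF Q]) auto
    then have "ys ! k * z {} \<in> ?Q k"
      using koszul_homotopy[of x c z "{}"] by (simp add: c koszul_def)
    moreover have "z {} \<in> I"
      by (rule 0) simp
    ultimately have "z {} \<in> ?Q k"
      by (rule nzd[OF k, rotated])
    then show ?case
      by (intro exI[of _ "\<lambda>_. 0"]) (simp add: koszul_def)
  next
    case (Suc i)
    define y where "y = ys ! k"
    have k: "k < length ys"
      using Suc.prems by simp
    then obtain c where c: "y = (\<Sum>j\<in>UNIV. c j * x j)"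
      using ideal_gen_rangeE[of y x] ys nth_mem unfolding y_def by blast
    have take: "set (take (Suc k) ys) = insert y (set (take k ys))"
      using k by (simp add: y_def take_Suc_conv_app_nth)
    define w where "w = contract c z"
    have hdz: "contract c (koszul x z) T \<in> ?Q k" if "card T = Suc i" for T
      using that Suc.prems(3) by (intro contract_mem[OF Q]) auto
    have dw: "koszul x w T = y * z T - contract c (koszul x z) T" for T
      using koszul_homotopy[of x c z T] by (simp add: w_def c eq_diff_eq)
    have "koszul x w T \<in> ?Q (Suc k)" if T: "card T = Suc i" for T
    proof -
      have "y * z T \<in> ?Q (Suc k)"
        using Suc.prems(2)[OF T] by (intro mult_mem_quot_sub) (auto simp: take)
      moreover have "?Q k \<subseteq> ?Q (Suc k)"
        by (rule quot_sub_mono) (auto simp: take)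
      ultimately show ?thesis
        unfolding dw using hdz[OF T] by (intro ideal.subspace_diff[OF Q]) auto
    qed
    moreover have "w T \<in> I" if "card T = i" for T
      unfolding w_def using that Suc.prems(2) by (intro contract_mem[OF assms(1)]) auto
    ultimately obtain v where v: "\<And>T. card T = i \<Longrightarrow> w T - koszul x v T \<in> ?Q (Suc k)"
      using Suc.IH[of "Suc k" w] Suc.prems(1) by auto
    have "\<exists>q u. card T = i \<longrightarrow> q \<in> ?Q k \<and> u \<in> I \<and> w T - koszul x v T = q + y * u" for T
      using v[of T, unfolded take] quot_sub_insertE[OF assms(1)] by metis
    then obtain q u where qu: "\<And>T. card T = i \<Longrightarrow>
        q T \<in> ?Q k \<and> u T \<in> I \<and> w T - koszul x v T = q T + y * u T"
      by metis
    have "z T - koszul x u T \<in> ?Q k" if T: "card T = Suc i" for T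
    proof -
      have "koszul x w T = koszul x (\<lambda>T. koszul x v T + (q T + y * u T)) T"
        using qu by (intro koszul_cong[OF T]) (metis add_diff_cancel_left' diff_add_cancel add.commute)
      also have "\<dots> = koszul x q T + y * koszul x u T"
        by (simp add: koszul_add koszul_mult koszul_koszul)
      finally have "y * (z T - koszul x u T) = contract c (koszul x z) T + koszul x q T"
        by (simp add: dw algebra_simps)
      moreover have "koszul x q T \<in> ?Q k"
        using qu by (intro koszul_mem[OF Q T]) auto
      ultimately have "ys ! k * (z T - koszul x u T) \<in> ?Q k"
        using hdz[OF T] ideal.subspace_add[OF Q] by (simp add: y_def)
      moreover have "z T - koszul x u T \<in> I"
        using qu Suc.prems(2)[OF T] by (intro ideal.subspace_diff[OF assms(1)] koszul_mem[OF assms(1) T]) auto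
      ultimately show ?thesis
        by (rule nzd[OF k, rotated])
    qed
    then show ?case
      using qu by (intro exI[of _ u]) auto
  }
qed

section \<open>Squarefree monomials\<close>

definition expo :: "'n::finite set \<Rightarrow> 'n \<Rightarrow>\<^sub>0 nat" where
  "expo G = Abs_poly_mapping (\<lambda>i. of_bool (i \<in> G))"

definition sqmono :: "'n::finite set \<Rightarrow> ('n, 'k::field) mpolynomial" where
  "sqmono G = Poly_Mapping.single (expo G) 1"

lemma lookup_expo [simp]: "Poly_Mapping.lookup (expo G) i = of_bool (i \<in> G)"
  by (simp add: expo_def)

lemma expo_eq_iff [simp]: "expo G = expo H \<longleftrightarrow> G = H"
  by (auto simp: poly_mapping_eq_iff fun_eq_iff)

lemma expo_add: "G \<inter> H = {} \<Longrightarrow> expo G + expo H = expo (G \<union> H)"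
  by (rule poly_mapping_eqI) (auto simp: lookup_add)

lemma expo_singleton: "expo {t} = Poly_Mapping.single t 1"
  by (rule poly_mapping_eqI) (auto simp: lookup_single when_def)

lemma sqmono_eq_iff [simp]: "sqmono G = sqmono H \<longleftrightarrow> G = H"
proof
  assume "sqmono G = (sqmono H :: ('a, 'b) mpolynomial)"
  then have "Poly_Mapping.keys (sqmono G :: ('a, 'b) mpolynomial) = Poly_Mapping.keys (sqmono H :: ('a, 'b) mpolynomial)"
    by simp
  then show "G = H"
    by (simp add: sqmono_def)
qed simp

lemma sqfree_monomials_eq: "(sqfree_monomials :: ('n::finite, 'k::field) mpolynomial set) = range sqmono"
proof -
  have "t \<in> range expo" if "\<forall>i. Poly_Mapping.lookup t i \<le> 1" for t :: "'n \<Rightarrow>\<^sub>0 nat"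
  proof
    show "t = expo {i. Poly_Mapping.lookup t i = 1}"
      using that by (intro poly_mapping_eqI) (auto simp: le_Suc_eq)
  qed simp
  then have "{t :: 'n \<Rightarrow>\<^sub>0 nat. \<forall>i. Poly_Mapping.lookup t i \<le> 1} = range expo"
    by (intro equalityI subsetI) auto
  then show ?thesis
    unfolding sqfree_monomials_def setcompr_eq_image by (simp add: sqmono_def image_image)
qed

lemma total_deg_sqmono [simp]: "total_deg (sqmono G) = card G"
  by (simp add: total_deg_def sqmono_def of_bool_def sum.If_cases)

lemma sqmono_mult: "G \<inter> H = {} \<Longrightarrow> sqmono G * sqmono H = sqmono (G \<union> H)"
  by (simp add: sqmono_def mult_single expo_add)

lemma sqmono_split: "G \<subseteq> H \<Longrightarrow> sqmono H = sqmono (H - G) * sqmono G"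
  by (subst sqmono_mult) (auto simp: Un_absorb2)

lemma indet_eq: "indet t = sqmono {t}"
  by (simp add: indet_def sqmono_def expo_singleton)

lemma sqmono_dvd_iff [simp]: "sqmono G dvd (sqmono H :: ('n::finite, 'k::field) mpolynomial) \<longleftrightarrow> G \<subseteq> H"
proof
  assume "sqmono G dvd (sqmono H :: ('n, 'k) mpolynomial)"
  then obtain r :: "('n, 'k) mpolynomial" where r: "sqmono H = sqmono G * r"
    by (auto elim: dvdE)
  have "expo H \<in> Poly_Mapping.keys (sqmono H :: ('n, 'k) mpolynomial)"
    by (simp add: sqmono_def)
  then obtain b where "expo H = expo G + b"
    unfolding r using keys_mult[of "sqmono G" r] by (auto simp: sqmono_def)
  then have "of_bool (i \<in> H) = of_bool (i \<in> G) + Poly_Mapping.lookup b i" for i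
    by (metis lookup_add lookup_expo)
  then show "G \<subseteq> H"
    by (metis add_is_0 of_bool_eq_0_iff subsetI)
next
  assume "G \<subseteq> H"
  then show "sqmono G dvd (sqmono H :: ('n, 'k) mpolynomial)"
    by (simp add: sqmono_split)
qed

lemma lookup_single_mult:
  fixes p :: "('n, 'k::field) mpolynomial"
  shows "Poly_Mapping.lookup (Poly_Mapping.single s 1 * p) (s + v) = Poly_Mapping.lookup p v"
  by (simp add: lookup_mult lookup_single when_mult)

lemma lookup_indet_mult:
  "Poly_Mapping.lookup (indet t * p) (expo T)
     = (if t \<in> T then Poly_Mapping.lookup p (expo (T - {t})) else 0)"
proof (cases "t \<in> T")
  case True
  then have "expo T = expo {t} + expo (T - {t})"
    by (simp add: expo_add insert_absorb)
  then show ?thesis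
    using True lookup_single_mult[of "expo {t}" p "expo (T - {t})"] by (simp add: indet_eq sqmono_def)
next
  case False
  have "expo T \<notin> Poly_Mapping.keys (indet t * p)"
  proof
    assume "expo T \<in> Poly_Mapping.keys (indet t * p)"
    then obtain b where "expo T = expo {t} + b"
      using keys_mult[of "indet t" p] by (auto simp: indet_eq sqmono_def)
    then have "Poly_Mapping.lookup (expo T) t = 1 + Poly_Mapping.lookup b t"
      by (simp add: lookup_add)
    then show False
      using False by simp
  qed
  then show ?thesis
    using False by (simp add: in_keys_iff)
qed

lemma lookup_kos_sign_mult:
  "Poly_Mapping.lookup (kos_sign t T * p :: ('n, 'k::field) mpolynomial) v = kos_sign t T * Poly_Mapping.lookup p v"
  by (cases "even (card {s \<in> T. to_nat s < to_nat t})") (auto simp: kos_sign_def)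

lemma lookup_koszul_indet:
  "Poly_Mapping.lookup (koszul indet u T) (expo S)
     = (\<Sum>t\<in>T. kos_sign t T * (if t \<in> S then Poly_Mapping.lookup (u (T - {t})) (expo (S - {t})) else 0))"
  by (simp add: koszul_def lookup_sum lookup_kos_sign_mult lookup_indet_mult)

text \<open>
  On the part of multidegree zero the Koszul differential of the variables is the simplicial
  coboundary: the monomial with exponent \<open>expo T\<close> sits at the index set \<open>T\<close> itself.
\<close>

lemma koszul_indet_single:
  "koszul indet (\<lambda>T. Poly_Mapping.single (expo T) (a T)) T
     = Poly_Mapping.single (expo T) (\<Sum>t\<in>T. kos_sign t T * a (T - {t}))"
proof (rule poly_mapping_eqI)
  fix v
  have "indet t * Poly_Mapping.single (expo (T - {t})) (a (T - {t})) = Poly_Mapping.single (expo T) (a (T - {t}))"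
    if "t \<in> T" for t
    using that by (simp add: indet_eq sqmono_def mult_single expo_add insert_absorb)
  then show "Poly_Mapping.lookup (koszul indet (\<lambda>T. Poly_Mapping.single (expo T) (a T)) T) v
     = Poly_Mapping.lookup (Poly_Mapping.single (expo T) (\<Sum>t\<in>T. kos_sign t T * a (T - {t}))) v"
    by (simp add: koszul_def lookup_sum lookup_kos_sign_mult lookup_single when_def)
qed

lemma sqfree_monomial_ideal_subspace: "sqfree_monomial_ideal I \<Longrightarrow> ideal.subspace I"
  by (auto simp: sqfree_monomial_ideal_def ideal_gen_def)

lemma ideal_gen_ideal: "sqfree_monomial_ideal I \<Longrightarrow> ideal_gen I = I"
  by (simp add: ideal_gen_def ideal.span_eq_iff sqfree_monomial_ideal_subspace)

lemma sqmono_mem_upward: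
  assumes "ideal.subspace I" "sqmono G \<in> I" "G \<subseteq> H"
  shows "sqmono H \<in> I"
  unfolding sqmono_split[OF assms(3)] by (rule ideal.subspace_scale[OF assms(1,2)])

text \<open>
  A monomial ideal contains each monomial of each of its elements, because the polynomials all of
  whose monomials are divisible by a generator form an ideal.
\<close>

lemma coeff_mem_monomial_ideal:
  fixes p :: "('n::finite, 'k::field) mpolynomial"
  assumes G: "G \<subseteq> sqfree_monomials" and p: "p \<in> ideal_gen G" and "Poly_Mapping.lookup p (expo T) \<noteq> 0"
  obtains H where "sqmono H \<in> G" "H \<subseteq> T"
proof -
  let ?S = "{p :: ('n, 'k) mpolynomial. \<forall>t \<in> Poly_Mapping.keys p. \<exists>H b. sqmono H \<in> G \<and> t = expo H + b}"
  have "ideal.subspace ?S"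
  proof (rule ideal.subspaceI)
    fix p q assume "p \<in> ?S" "q \<in> ?S"
    then show "p + q \<in> ?S"
      using keys_add[of p q] by blast
  next
    fix r p assume p: "p \<in> ?S"
    show "r * p \<in> ?S"
    proof (intro CollectI ballI)
      fix t assume "t \<in> Poly_Mapping.keys (r * p)"
      then obtain a s where "t = a + s" "s \<in> Poly_Mapping.keys p"
        using keys_mult[of r p] by blast
      moreover from this obtain H b where "sqmono H \<in> G" "s = expo H + b"
        using p by blast
      ultimately show "\<exists>H b. sqmono H \<in> G \<and> t = expo H + b"
        by (metis add.left_commute)
    qed
  qed simp
  moreover have "G \<subseteq> ?S"
  proof
    fix g assume "g \<in> G"
    moreover from this obtain H where "g = sqmono H"
      using G by (auto simp: sqfree_monomials_eq)
    ultimately show "g \<in> ?S"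
      by (auto simp: sqmono_def intro!: exI[of _ H] exI[of _ 0])
  qed
  ultimately have "p \<in> ?S"
    using p ideal.span_minimal unfolding ideal_gen_def by blast
  moreover have "expo T \<in> Poly_Mapping.keys p"
    using assms(3) by (simp add: in_keys_iff)
  ultimately obtain H b where H: "sqmono H \<in> G" and "expo T = expo H + b"
    by blast
  then have "of_bool (i \<in> T) = of_bool (i \<in> H) + Poly_Mapping.lookup b i" for i
    by (metis lookup_add lookup_expo)
  then have "H \<subseteq> T"
    by (metis add_is_0 of_bool_eq_0_iff subsetI)
  with H show thesis
    using that by blast
qed

lemma sqmono_mem_if_coeff:
  fixes p :: "('n::finite, 'k::field) mpolynomial"
  assumes "sqfree_monomial_ideal I" "p \<in> I" "Poly_Mapping.lookup p (expo T) \<noteq> 0"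
  shows "sqmono T \<in> I"
proof -
  obtain G where G: "G \<subseteq> sqfree_monomials" "I = ideal_gen G"
    using assms(1) unfolding sqfree_monomial_ideal_def by blast
  then obtain H where "sqmono H \<in> G" "H \<subseteq> T"
    using coeff_mem_monomial_ideal assms(2,3) by metis
  moreover from this have "sqmono H \<in> I"
    unfolding G(2) ideal_gen_def by (intro ideal.span_base)
  ultimately show ?thesis
    using sqmono_mem_upward sqfree_monomial_ideal_subspace[OF assms(1)] by blast
qed

section \<open>Cohomology in the two lowest degrees\<close>

text \<open>
  The situation to be refuted: \<open>F\<close> is the unique support of least size in \<open>I\<close>, and there is a
  regular sequence on \<open>I / J\<close> of length at least \<open>card F + 2\<close>.
\<close>

locale deep_quotient =
  fixes I J :: "('n::finite, 'k::field) mpolynomial set" and F :: "'n set"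
    and ys :: "('n, 'k) mpolynomial list"
  assumes I: "sqfree_monomial_ideal I" and J: "sqfree_monomial_ideal J" and "J \<subseteq> I"
    and F: "sqmono F \<in> I"
    and degree_gt: "\<And>G. sqmono G \<in> I \<Longrightarrow> G \<noteq> F \<Longrightarrow> card F < card G"
    and ys: "set ys \<subseteq> max_graded_ideal" "regular_seq I J ys" "card F + 1 < length ys"
begin

definition P :: "'n set set" where
  "P = {G. sqmono G \<in> I - J}"

definition B :: "'n set set" where
  "B = {b \<in> P. card b = card F + 1}"

definition C :: "'n set set" where
  "C = {c \<in> P. card c = card F + 2}"

definition multiples :: "'n set \<Rightarrow> 'n set set" where
  "multiples b = {c \<in> C. b \<subseteq> c}"

lemma P_convex: "G \<in> P \<Longrightarrow> K \<in> P \<Longrightarrow> G \<subseteq> H \<Longrightarrow> H \<subseteq> K \<Longrightarrow> H \<in> P"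
  unfolding P_def using sqmono_mem_upward[OF sqfree_monomial_ideal_subspace[OF I]]
    sqmono_mem_upward[OF sqfree_monomial_ideal_subspace[OF J]] by blast

lemma cocycle_is_coboundary:
  assumes "i \<le> card F + 1"
    and "\<And>T. card T = i \<Longrightarrow> z T \<in> I" and "\<And>T. card T = Suc i \<Longrightarrow> koszul indet z T \<in> J"
  shows "\<exists>u. (\<forall>T. Suc (card T) = i \<longrightarrow> u T \<in> I) \<and> (\<forall>T. card T = i \<longrightarrow> z T - koszul indet u T \<in> J)"
proof -
  have "quot_sub I J (set (take 0 ys)) = J"
    by (simp add: quot_sub_empty ideal_gen_ideal[OF J])
  then show ?thesis
    using koszul_exact[of I ys indet J 0 i z] assms ys
    unfolding max_graded_ideal_def by (simp add: sqfree_monomial_ideal_subspace[OF I])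
qed

lemma coeff_degree_ge:
  assumes "p \<in> I" "Poly_Mapping.lookup p (expo T) \<noteq> 0"
  shows "T = F \<or> card F < card T"
  using degree_gt sqmono_mem_if_coeff[OF I assms] by blast

text \<open>
  Exactness makes \<open>a\<close> the coboundary of a cochain with values in \<open>I\<close>. At a set \<open>G\<close> of size
  \<open>card F\<close>, the coefficient of that cochain at \<open>expo G\<close> can be nonzero only for \<open>G = F\<close>. So \<open>a\<close>
  is, up to the scalar \<open>\<kappa>\<close>, the coboundary of the indicator function of \<open>F\<close>.
\<close>

lemma cocycle_support:
  fixes a :: "'n set \<Rightarrow> 'k"
  assumes supp: "\<And>T. a T \<noteq> 0 \<Longrightarrow> T \<in> B"
    and cocycle: "\<And>c. c \<in> C \<Longrightarrow> (\<Sum>t\<in>c. kos_sign t c * a (c - {t})) = 0"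
    and "a b\<^sub>0 \<noteq> 0"
  shows "F \<subseteq> b\<^sub>0" and "b \<in> B \<Longrightarrow> F \<subseteq> b \<Longrightarrow> a b \<noteq> 0"
proof -
  note subI = sqfree_monomial_ideal_subspace[OF I] and subJ = sqfree_monomial_ideal_subspace[OF J]
  define z :: "'n set \<Rightarrow> ('n, 'k) mpolynomial" where
    "z T = Poly_Mapping.single (expo T) (a T)" for T
  have scal: "Poly_Mapping.single (expo T) r = Poly_Mapping.single 0 r * (sqmono T :: ('n, 'k) mpolynomial)" for T r
    by (simp add: sqmono_def mult_single)
  have zI: "z T \<in> I" for T
  proof (cases "a T = 0")
    case True
    then show ?thesis
      using ideal.subspace_0[OF subI] by (simp add: z_def)
  next
    case False
    then have "sqmono T \<in> I"
      using supp by (auto simp: B_def P_def)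
    then show ?thesis
      unfolding z_def scal by (rule ideal.subspace_scale[OF subI])
  qed
  have dz: "koszul indet z T \<in> J" if T: "card T = Suc (card F + 1)" for T
  proof -
    have eq: "koszul indet z T = Poly_Mapping.single (expo T) (\<Sum>t\<in>T. kos_sign t T * a (T - {t}))"
      unfolding z_def by (rule koszul_indet_single)
    show ?thesis
    proof (cases "sqmono T \<in> J")
      case True
      then show ?thesis
        unfolding eq scal by (rule ideal.subspace_scale[OF subJ])
    next
      case False
      have "(\<Sum>t\<in>T. kos_sign t T * a (T - {t})) = 0"
      proof (cases "sqmono T \<in> I")
        case True
        then show ?thesis
          using False T by (intro cocycle) (simp add: C_def P_def)
      next
        case notI: False
        have "a (T - {t}) = 0" for t
        proof (rule ccontr)
          assume "a (T - {t}) \<noteq> 0"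
          then have "sqmono (T - {t}) \<in> I"
            using supp by (auto simp: B_def P_def)
          then show False
            using notI sqmono_mem_upward[OF subI, of "T - {t}" T] by auto
        qed
        then show ?thesis
          by simp
      qed
      then show ?thesis
        unfolding eq using ideal.subspace_0[OF subJ] by simp
    qed
  qed
  obtain u where u: "\<And>T. Suc (card T) = card F + 1 \<Longrightarrow> u T \<in> I"
    and zu: "\<And>T. card T = card F + 1 \<Longrightarrow> z T - koszul indet u T \<in> J"
    using cocycle_is_coboundary[where z = z, OF order_refl zI dz] by blast
  define \<kappa> where "\<kappa> = Poly_Mapping.lookup (u F) (expo F)"
  have \<omega>: "Poly_Mapping.lookup (u G) (expo G) = (if G = F then \<kappa> else 0)" if "card G = card F" for G
  proof (cases "G = F")
    case False
    have "u G \<in> I"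
      using that by (intro u) simp
    from coeff_degree_ge[OF this, of G] have "Poly_Mapping.lookup (u G) (expo G) = 0"
      using False that by (metis less_irrefl)
    then show ?thesis
      using False by simp
  qed (simp add: \<kappa>_def)
  have a: "a b = (\<Sum>t\<in>b. kos_sign t b * (if b - {t} = F then \<kappa> else 0))" if "b \<in> B" for b
  proof -
    have cb: "card b = card F + 1" and "sqmono b \<notin> J"
      using that by (auto simp: B_def P_def)
    then have "Poly_Mapping.lookup (z b - koszul indet u b) (expo b) = 0"
      using sqmono_mem_if_coeff[OF J zu[OF cb]] by blast
    then have "a b = (\<Sum>t\<in>b. kos_sign t b * Poly_Mapping.lookup (u (b - {t})) (expo (b - {t})))"
      by (simp add: z_def lookup_minus lookup_koszul_indet)
    also have "\<dots> = (\<Sum>t\<in>b. kos_sign t b * (if b - {t} = F then \<kappa> else 0))"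
      using cb by (intro sum.cong refl arg_cong2[of _ _ _ _ "(*)"] \<omega>) simp
    finally show ?thesis .
  qed
  have "(\<Sum>t\<in>b\<^sub>0. kos_sign t b\<^sub>0 * (if b\<^sub>0 - {t} = F then \<kappa> else 0)) \<noteq> 0"
    using assms(3) a[OF supp[OF assms(3)]] by simp
  then obtain t where "kos_sign t b\<^sub>0 * (if b\<^sub>0 - {t} = F then \<kappa> else 0) \<noteq> 0"
    by (rule sum.not_neutral_contains_not_neutral)
  then have "b\<^sub>0 - {t} = F" "\<kappa> \<noteq> 0"
    by (auto split: if_splits)
  then show "F \<subseteq> b\<^sub>0"
    by blast
  assume b: "b \<in> B" "F \<subseteq> b"
  then have "card (b - F) = 1"
    by (simp add: B_def card_Diff_subset)
  then obtain s where s: "b - F = {s}"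
    by (auto simp: card_1_singleton_iff)
  then have iff: "b - {t} = F \<longleftrightarrow> t = s" if "t \<in> b" for t
    using b(2) that by blast
  have "s \<in> b"
    using s by blast
  have "(\<Sum>t\<in>b. kos_sign t b * (if b - {t} = F then \<kappa> else 0)) = (\<Sum>t\<in>b. if t = s then kos_sign t b * \<kappa> else 0)"
    using iff by (intro sum.cong) simp_all
  then show "a b \<noteq> 0"
    using a[OF b(1)] \<open>\<kappa> \<noteq> 0\<close> \<open>s \<in> b\<close> by simp
qed

text \<open>
  If \<open>X\<close> had fewer neighbours than elements, the homogeneous system that expresses being a cocycle
  supported on \<open>X\<close> would have more unknowns than equations. A nontrivial solution is nonzero at
  every member of \<open>B\<close> above \<open>F\<close>, so all of these lie in \<open>X\<close>.
\<close>

lemma hall_condition: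
  assumes "X \<subseteq> B" and "F \<in> P \<Longrightarrow> \<not> {b \<in> B. F \<subseteq> b} \<subseteq> X"
  shows "card X \<le> card (\<Union>(multiples ` X))"
proof (rule ccontr)
  let ?N = "\<Union>(multiples ` X)"
  define M :: "'n set \<Rightarrow> 'n set \<Rightarrow> 'k" where
    "M c b = (\<Sum>t\<in>c. if c - {t} = b then kos_sign t c else 0)" for c b
  assume "\<not> card X \<le> card ?N"
  then obtain a where a: "\<exists>b\<in>X. a b \<noteq> 0" "\<And>c. c \<in> ?N \<Longrightarrow> (\<Sum>b\<in>X. M c b * a b) = 0"
    using underdetermined_system[of ?N X M] by auto
  define a' where "a' T = (if T \<in> X then a T else 0)" for T
  from a(1) obtain b\<^sub>0 where b\<^sub>0: "b\<^sub>0 \<in> X" "a' b\<^sub>0 \<noteq> 0"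
    by (auto simp: a'_def)
  have supp: "T \<in> X" if "a' T \<noteq> 0" for T
    using that by (auto simp: a'_def split: if_splits)
  have cocycle: "(\<Sum>t\<in>c. kos_sign t c * a' (c - {t})) = 0" if "c \<in> C" for c
  proof (cases "c \<in> ?N")
    case True
    have "(\<Sum>t\<in>c. kos_sign t c * a' (c - {t})) = (\<Sum>t\<in>c. \<Sum>b\<in>X. (if c - {t} = b then kos_sign t c else 0) * a b)"
    proof (rule sum.cong[OF refl])
      fix t
      have "(\<Sum>b\<in>X. (if c - {t} = b then kos_sign t c else 0) * a b)
          = (\<Sum>b\<in>X. if c - {t} = b then kos_sign t c * a b else 0)"
        by (intro sum.cong) auto
      then show "kos_sign t c * a' (c - {t}) = (\<Sum>b\<in>X. (if c - {t} = b then kos_sign t c else 0) * a b)"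
        by (simp add: a'_def)
    qed
    also have "\<dots> = (\<Sum>b\<in>X. M c b * a b)"
      by (subst sum.swap) (simp add: M_def sum_distrib_right)
    finally show ?thesis
      using a(2)[OF True] by simp
  next
    case False
    then have "c - {t} \<notin> X" for t
      using that by (auto simp: multiples_def)
    then show ?thesis
      by (simp add: a'_def)
  qed
  have suppB: "T \<in> B" if "a' T \<noteq> 0" for T
    using supp[OF that] assms(1) by blast
  note support = cocycle_support[of a', OF suppB cocycle b\<^sub>0(2)]
  have "b\<^sub>0 \<in> P"
    using b\<^sub>0(1) assms(1) by (auto simp: B_def)
  then have "sqmono F \<notin> J"
    using support(1) sqmono_mem_upward[OF sqfree_monomial_ideal_subspace[OF J], of F b\<^sub>0]
    by (auto simp: P_def)
  then have "F \<in> P"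
    using F by (simp add: P_def)
  moreover have "{b \<in> B. F \<subseteq> b} \<subseteq> X"
    using support(2) supp by blast
  ultimately show False
    using assms(2) by blast
qed

text \<open>
  Were \<open>insert t F\<close> outside \<open>P\<close> for all \<open>t \<notin> H\<close>, the cochain with the single value \<open>sqmono F\<close> at
  \<open>H\<close> would be a cocycle modulo \<open>J\<close>. It is no coboundary, since for that \<open>I\<close> would need a monomial of
  degree below \<open>card F\<close>. The cases \<open>H = F\<close> and \<open>H = insert t F\<close> yield two members of \<open>B\<close> above \<open>F\<close>.
\<close>

lemma F_extends:
  assumes "F \<in> P" and "F \<subseteq> H" and "card H \<le> card F + 1"
  shows "\<exists>t. t \<notin> H \<and> insert t F \<in> B"
proof (rule ccontr)
  assume none: "\<not> ?thesis"
  note subI = sqfree_monomial_ideal_subspace[OF I] and subJ = sqfree_monomial_ideal_subspace[OF J]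
  have inJ: "sqmono (insert t F) \<in> J" if "t \<notin> H" for t
  proof -
    have "card (insert t F) = card F + 1"
      using that assms(2) by (subst card_insert_disjoint) auto
    moreover have "sqmono (insert t F) \<in> I"
      using sqmono_mem_upward[OF subI F] by blast
    ultimately show ?thesis
      using none that unfolding B_def P_def by blast
  qed
  define z :: "'n set \<Rightarrow> ('n, 'k) mpolynomial" where "z T = (if T = H then sqmono F else 0)" for T
  have dz: "koszul indet z T \<in> J" for T
    unfolding koszul_def
  proof (rule ideal.subspace_sum[OF subJ], rule ideal.subspace_scale[OF subJ])
    fix t assume "t \<in> T"
    show "indet t * z (T - {t}) \<in> J"
    proof (cases "T - {t} = H")
      case True
      then have "t \<notin> H"
        by blast
      moreover from this have "indet t * sqmono F = (sqmono (insert t F) :: ('n, 'k) mpolynomial)"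
        using assms(2) by (subst indet_eq, subst sqmono_mult) auto
      ultimately show ?thesis
        using inJ True by (simp add: z_def)
    next
      case False
      then show ?thesis
        using ideal.subspace_0[OF subJ] by (simp add: z_def)
    qed
  qed
  have zI: "z T \<in> I" for T
    using F ideal.subspace_0[OF subI] by (simp add: z_def)
  obtain u where u: "\<And>T. Suc (card T) = card H \<Longrightarrow> u T \<in> I"
    and zu: "\<And>T. card T = card H \<Longrightarrow> z T - koszul indet u T \<in> J"
    using cocycle_is_coboundary[where z = z, OF assms(3) zI dz] by blast
  have "Poly_Mapping.lookup (u (H - {t})) (expo (F - {t})) = 0" if "t \<in> H" "t \<in> F" for t
  proof (rule ccontr)
    assume "Poly_Mapping.lookup (u (H - {t})) (expo (F - {t})) \<noteq> 0"
    moreover have "u (H - {t}) \<in> I"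
      using that(1) by (intro u card_Suc_Diff1) simp_all
    ultimately have "F - {t} = F \<or> card F < card (F - {t})"
      using coeff_degree_ge by blast
    moreover have "card (F - {t}) \<le> card F"
      by (rule card_Diff1_le)
    ultimately show False
      using that(2) by auto
  qed
  then have "Poly_Mapping.lookup (koszul indet u H) (expo F) = 0"
    by (auto simp: lookup_koszul_indet intro!: sum.neutral)
  then have "Poly_Mapping.lookup (z H - koszul indet u H) (expo F) \<noteq> 0"
    by (simp add: lookup_minus z_def sqmono_def)
  then have "sqmono F \<in> J"
    using sqmono_mem_if_coeff[OF J zu[OF refl]] by blast
  then show False
    using assms(1) by (simp add: P_def)
qed

end

section \<open>Interval partitions\<close>

lemma interval_sqmono:
  assumes "P = sqmono ` PP"
  shows "interval P (sqmono u) (sqmono v) = sqmono ` {G \<in> PP. u \<subseteq> G \<and> G \<subseteq> v}"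
  by (auto simp: interval_def assms)

text \<open>
  Intervals only have to be chosen around the monomials of degree below \<open>m\<close>; everything else may
  be covered by one-element intervals.
\<close>

lemma sdepth_geI:
  fixes I J :: "('n::finite, 'k::field) mpolynomial set"
  assumes P: "P = {G. sqmono G \<in> I - J}"
    and "P \<noteq> {}"
    and D: "\<And>u v. (u, v) \<in> D \<Longrightarrow> u \<in> P \<and> v \<in> P \<and> u \<subseteq> v \<and> m \<le> card v"
    and disj: "disjoint_family_on (\<lambda>(u, v). {G \<in> P. u \<subseteq> G \<and> G \<subseteq> v}) D"
    and cover: "\<And>G. G \<in> P \<Longrightarrow> card G < m \<Longrightarrow> \<exists>(u, v) \<in> D. u \<subseteq> G \<and> G \<subseteq> v"
  shows "m \<le> sdepth I J"
proof -
  define itv where "itv = (\<lambda>(u, v). {G \<in> P. u \<subseteq> G \<and> G \<subseteq> v})"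
  define S where "S = {(G, G) | G. G \<in> P - (\<Union>p\<in>D. itv p)}"
  define mono2 :: "'n set \<times> 'n set \<Rightarrow> ('n, 'k) mpolynomial \<times> ('n, 'k) mpolynomial" where
    "mono2 = map_prod sqmono sqmono"
  define Q where "Q = mono2 ` (D \<union> S)"
  have poset: "sqfree_poset I J = sqmono ` P"
    by (auto simp: sqfree_poset_def sqfree_monomials_eq P)
  have inP: "u \<in> P \<and> v \<in> P \<and> u \<subseteq> v \<and> m \<le> card v" if "(u, v) \<in> D \<union> S" for u v
  proof (cases "(u, v) \<in> D")
    case True
    then show ?thesis
      using D by blast
  next
    case False
    with that have S: "u = v" "v \<in> P" "v \<notin> (\<Union>p\<in>D. itv p)"
      by (auto simp: S_def)
    then have "m \<le> card v"
      using cover[of v] by (fastforce simp: itv_def)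
    with S show ?thesis
      by blast
  qed
  have itv_eq: "(case mono2 p of (u, v) \<Rightarrow> interval (sqfree_poset I J) u v) = sqmono ` itv p" for p
    using interval_sqmono[OF poset] by (auto simp: mono2_def itv_def split: prod.splits)
  have itv_S: "\<exists>G. p = (G, G) \<and> itv p = {G} \<and> G \<notin> (\<Union>p\<in>D. itv p)" if p: "p \<in> S" for p
  proof -
    obtain G where "p = (G, G)" "G \<in> P" "G \<notin> (\<Union>p\<in>D. itv p)"
      using p by (auto simp: S_def)
    moreover from this have "itv p = {G}"
      by (auto simp: itv_def)
    ultimately show ?thesis
      by blast
  qed
  have disj': "disjoint_family_on itv (D \<union> S)"
    unfolding disjoint_family_on_def
  proof (intro ballI impI)
    fix p p' assume pp: "p \<in> D \<union> S" "p' \<in> D \<union> S" "p \<noteq> p'"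
    consider "p \<in> D" "p' \<in> D" | "p \<in> D" "p' \<in> S" | "p \<in> S" "p' \<in> D" | "p \<in> S" "p' \<in> S"
      using pp by blast
    then show "itv p \<inter> itv p' = {}"
    proof cases
      case 1
      then show ?thesis
        using disj[folded itv_def] pp(3) unfolding disjoint_family_on_def by blast
    next
      case 2
      then obtain G where "itv p' = {G}" "G \<notin> (\<Union>p\<in>D. itv p)"
        using itv_S[of p'] by blast
      with 2 show ?thesis
        by auto
    next
      case 3
      then obtain G where "itv p = {G}" "G \<notin> (\<Union>p\<in>D. itv p)"
        using itv_S[of p] by blast
      with 3 show ?thesis
        by auto
    next
      case 4
      then obtain G G' where "p = (G, G)" "itv p = {G}" "p' = (G', G')" "itv p' = {G'}"
        using itv_S[of p] itv_S[of p'] by blast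
      with pp(3) show ?thesis
        by simp
    qed
  qed
  have "disjoint_family_on (\<lambda>(u, v). interval (sqfree_poset I J) u v) Q"
    unfolding disjoint_family_on_def
  proof (intro ballI impI)
    fix r r' assume "r \<in> Q" "r' \<in> Q" "r \<noteq> r'"
    then obtain p p' where p: "p \<in> D \<union> S" "p' \<in> D \<union> S" "p \<noteq> p'" "r = mono2 p" "r' = mono2 p'"
      unfolding Q_def by blast
    then have "itv p \<inter> itv p' = {}"
      using disj' unfolding disjoint_family_on_def by blast
    then have "sqmono ` itv p \<inter> (sqmono ` itv p' :: ('n, 'k) mpolynomial set) = {}"
      by auto
    then show "(case r of (u, v) \<Rightarrow> interval (sqfree_poset I J) u v)
        \<inter> (case r' of (u, v) \<Rightarrow> interval (sqfree_poset I J) u v) = {}"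
      unfolding p(4,5) itv_eq .
  qed
  moreover have "(\<Union>(u, v)\<in>Q. interval (sqfree_poset I J) u v) = sqfree_poset I J"
  proof -
    have "(\<Union>(u, v)\<in>Q. interval (sqfree_poset I J) u v) = sqmono ` (\<Union>p\<in>D \<union> S. itv p)"
      unfolding Q_def by (simp add: itv_eq image_UN image_Un)
    also have "(\<Union>p\<in>D \<union> S. itv p) = P"
    proof
      show "(\<Union>p\<in>D \<union> S. itv p) \<subseteq> P"
        by (auto simp: itv_def)
      show "P \<subseteq> (\<Union>p\<in>D \<union> S. itv p)"
      proof
        fix G assume "G \<in> P"
        then show "G \<in> (\<Union>p\<in>D \<union> S. itv p)"
        proof (cases "G \<in> (\<Union>p\<in>D. itv p)")
          case False
          with \<open>G \<in> P\<close> have "(G, G) \<in> S"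
            by (auto simp: S_def)
          then show ?thesis
            using itv_S by blast
        qed blast
      qed
    qed
    finally show ?thesis
      by (simp add: poset)
  qed
  moreover have "\<forall>(u, v)\<in>Q. u \<in> sqfree_poset I J \<and> v \<in> sqfree_poset I J \<and> u dvd v"
    using inP by (fastforce simp: Q_def mono2_def poset)
  ultimately have Q: "Q \<in> interval_partitions (sqfree_poset I J)"
    by (simp add: interval_partitions_def)
  have sub: "sqfree_poset I J \<subseteq> sqfree_monomials"
    by (simp add: sqfree_poset_def)
  have "finite Q"
    by (rule finite_interval_partitions(2)[OF sub Q])
  moreover have "Q \<noteq> {}"
    using Q \<open>P \<noteq> {}\<close> by (auto simp: interval_partitions_def poset)
  moreover have "\<forall>(u, v)\<in>Q. m \<le> total_deg v"
    using inP by (fastforce simp: Q_def mono2_def)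
  ultimately have "m \<le> sdepth_partition Q"
    unfolding sdepth_partition_def by (subst Min_ge_iff) auto
  also have "\<dots> \<le> sdepth I J"
    unfolding sdepth_def using Q finite_interval_partitions(1)[OF sub] by (intro Max_ge) auto
  finally show ?thesis .
qed

lemma card_Suc_no_between:
  assumes "finite c" "b \<subseteq> G" "G \<subseteq> c" "card c = card b + 1"
  shows "G = b \<or> G = c"
proof -
  have "finite G"
    using assms(1,3) by (rule finite_subset[rotated])
  then have "card b \<le> card G" "card G \<le> card c"
    by (intro card_mono assms \<open>finite G\<close>)+
  then consider "card b = card G" | "card G = card c"
    using assms(4) by linarith
  then show ?thesis
    using card_subset_eq[OF \<open>finite G\<close> assms(2)] card_subset_eq[OF assms(1,3)] by cases simp_all
qed

context deep_quotient
begin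

lemma degree_cases:
  assumes "G \<in> P" "card G < card F + 2"
  shows "G = F \<or> G \<in> B"
proof (cases "G = F")
  case False
  then have "card F < card G"
    using assms(1) degree_gt[of G] by (simp add: P_def)
  with assms show ?thesis
    by (simp add: B_def)
qed simp

lemma disjoint_matching_intervals:
  assumes "matching multiples A \<nu>" "A \<subseteq> B"
  shows "disjoint_family_on (\<lambda>(u, v). {G \<in> P. u \<subseteq> G \<and> G \<subseteq> v}) ((\<lambda>b. (b, \<nu> b)) ` A)"
    and "b \<in> A \<Longrightarrow> {G \<in> P. b \<subseteq> G \<and> G \<subseteq> \<nu> b} = {b, \<nu> b}"
proof -
  have itv: "{G \<in> P. b \<subseteq> G \<and> G \<subseteq> \<nu> b} = {b, \<nu> b}" if "b \<in> A" for b
  proof -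
    have "b \<in> B" "\<nu> b \<in> C" "b \<subseteq> \<nu> b"
      using that assms by (auto simp: matching_def multiples_def)
    then show ?thesis
      using card_Suc_no_between[of "\<nu> b" b] by (auto simp: B_def C_def)
  qed
  then show "b \<in> A \<Longrightarrow> {G \<in> P. b \<subseteq> G \<and> G \<subseteq> \<nu> b} = {b, \<nu> b}" .
  have "{b, \<nu> b} \<inter> {b', \<nu> b'} = {}" if "b \<in> A" "b' \<in> A" "b \<noteq> b'" for b b'
  proof -
    have "card b = card F + 1" "card b' = card F + 1" "card (\<nu> b) = card F + 2" "card (\<nu> b') = card F + 2"
      using that assms by (auto simp: matching_def multiples_def B_def C_def)
    moreover have "\<nu> b \<noteq> \<nu> b'"
      using that assms(1) by (auto simp: matching_def inj_on_def)
    ultimately show ?thesis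
      using that(3) by auto
  qed
  then show "disjoint_family_on (\<lambda>(u, v). {G \<in> P. u \<subseteq> G \<and> G \<subseteq> v}) ((\<lambda>b. (b, \<nu> b)) ` A)"
    using itv by (auto simp: disjoint_family_on_def)
qed

lemma sdepth_ge_if_F_notin:
  assumes "F \<notin> P" and "P \<noteq> {}"
  shows "card F + 2 \<le> sdepth I J"
proof -
  obtain \<nu> where \<nu>: "matching multiples B \<nu>"
    using hall_marriage[of B multiples] hall_condition assms(1) by auto
  show ?thesis
  proof (rule sdepth_geI[OF P_def, where D = "(\<lambda>b. (b, \<nu> b)) ` B"])
    show "u \<in> P \<and> v \<in> P \<and> u \<subseteq> v \<and> card F + 2 \<le> card v"
      if "(u, v) \<in> (\<lambda>b. (b, \<nu> b)) ` B" for u v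
      using that \<nu> by (auto simp: matching_def multiples_def B_def C_def)
    show "\<exists>(u, v) \<in> (\<lambda>b. (b, \<nu> b)) ` B. u \<subseteq> G \<and> G \<subseteq> v" if "G \<in> P" "card G < card F + 2" for G
      using degree_cases[OF that] that(1) assms(1) \<nu> by (auto simp: matching_def multiples_def)
  qed (use assms(2) disjoint_matching_intervals(1)[OF \<nu>] in auto)
qed

text \<open>
  A member \<open>c\<close> of \<open>C\<close> above \<open>F\<close> is \<open>F\<close> together with two variables. By convexity of \<open>P\<close>, both of the
  sets strictly between \<open>F\<close> and \<open>c\<close> belong to \<open>B\<close>: this is the graph structure on the members of \<open>B\<close>
  above \<open>F\<close>.
\<close>

lemma multiples_edge:
  assumes "b \<in> B" "F \<subseteq> b" "c \<in> multiples b" "F \<in> P"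
  shows "\<exists>b' \<in> B. F \<subseteq> b' \<and> b' \<noteq> b \<and> c \<in> multiples b' \<and>
    (\<forall>G. F \<subseteq> G \<and> G \<subseteq> c \<longrightarrow> G = F \<or> G = b \<or> G = b' \<or> G = c)"
proof -
  have c: "c \<in> C" "b \<subseteq> c"
    using assms(3) by (auto simp: multiples_def)
  have "card (c - F) = 2" "card (b - F) = 1"
    using assms(1,2) c by (auto simp: B_def C_def card_Diff_subset)
  then obtain s t where st: "c - F = {s, t}" "s \<noteq> t" and "\<exists>r. b - F = {r}"
    by (auto simp: card_2_iff card_1_singleton_iff)
  then obtain r where r: "b - F = {r}"
    by blast
  then have "r = s \<or> r = t"
    using st(1) c(2) by blast
  then obtain r' where r': "c - F = {r, r'}" "r \<noteq> r'"
    using st by blast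
  define b' where "b' = insert r' F"
  have eq: "b = insert r F" "c = insert r (insert r' F)" "r \<notin> F" "r' \<notin> F"
    using r r' assms(2) c(2) by blast+
  have "b' \<subseteq> c" "F \<subseteq> b'"
    by (auto simp: b'_def eq)
  moreover have "b' \<in> P"
    using P_convex[OF assms(4) _ \<open>F \<subseteq> b'\<close> \<open>b' \<subseteq> c\<close>] c(1) by (simp add: C_def)
  moreover have "card b' = card F + 1"
    using eq by (simp add: b'_def)
  ultimately have "b' \<in> B" "F \<subseteq> b'" "c \<in> multiples b'" "b' \<noteq> b"
    using c(1) r' eq by (auto simp: B_def multiples_def b'_def)
  moreover have "G = F \<or> G = b \<or> G = b' \<or> G = c" if "F \<subseteq> G" "G \<subseteq> c" for G
    using that unfolding b'_def eq by (cases "r \<in> G"; cases "r' \<in> G") auto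
  ultimately show ?thesis
    by blast
qed

lemma sdepth_ge_if_F_in:
  assumes "F \<in> P"
  shows "card F + 2 \<le> sdepth I J"
proof -
  define V where "V = {b \<in> B. F \<subseteq> b}"
  obtain t\<^sub>0 where t\<^sub>0: "t\<^sub>0 \<notin> F" "insert t\<^sub>0 F \<in> B"
    using F_extends[OF assms order_refl] by auto
  then obtain t\<^sub>1 where t\<^sub>1: "t\<^sub>1 \<notin> insert t\<^sub>0 F" "insert t\<^sub>1 F \<in> B"
    using F_extends[OF assms, of "insert t\<^sub>0 F"] by auto
  have "\<exists>v w c \<nu>. v \<in> V \<and> w \<in> V \<and> v \<noteq> w \<and> c \<in> multiples v \<and> c \<in> multiples w \<and>
           matching (\<lambda>a. multiples a - {c}) (B - {v, w}) \<nu>"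
  proof (rule matching_contract_edge)
    show "insert t\<^sub>0 F \<in> V" "insert t\<^sub>1 F \<in> V" "insert t\<^sub>0 F \<noteq> insert t\<^sub>1 F"
      using t\<^sub>0 t\<^sub>1 by (auto simp: V_def)
    show "card Y \<le> card (\<Union>(multiples ` Y))" if "Y \<subseteq> B" "\<not> V \<subseteq> Y" for Y
      using that hall_condition by (simp add: V_def)
    show "\<exists>w \<in> V. w \<noteq> v \<and> c \<in> multiples w" if v: "v \<in> V" and c: "c \<in> multiples v" for v c
    proof -
      have "v \<in> B" "F \<subseteq> v"
        using v by (auto simp: V_def)
      then obtain w where "w \<in> B" "F \<subseteq> w" "w \<noteq> v" "c \<in> multiples w"
        using multiples_edge[OF _ _ c assms] by meson
      then show ?thesis
        unfolding V_def by blast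
    qed
  qed (auto simp: V_def)
  then obtain v w c \<nu> where vw: "v \<in> V" "w \<in> V" "v \<noteq> w" and c: "c \<in> multiples v" "c \<in> multiples w"
    and "matching (\<lambda>a. multiples a - {c}) (B - {v, w}) \<nu>"
    by blast
  then have \<nu>: "matching multiples (B - {v, w}) \<nu>" and \<nu>c: "c \<notin> \<nu> ` (B - {v, w})"
    by (auto simp: matching_def)
  have vwB: "v \<in> B" "w \<in> B" "F \<subseteq> v" "F \<subseteq> w"
    using vw by (auto simp: V_def)
  have cC: "c \<in> C" "v \<subseteq> c" "w \<subseteq> c"
    using c by (auto simp: multiples_def)
  obtain w' where w': "\<And>G. F \<subseteq> G \<Longrightarrow> G \<subseteq> c \<Longrightarrow> G = F \<or> G = v \<or> G = w' \<or> G = c"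
    using multiples_edge[OF vwB(1,3) c(1) assms] by meson
  have "w \<noteq> F" "w \<noteq> c"
    using vwB cC(1) by (auto simp: B_def C_def)
  then have "w' = w"
    using w'[OF vwB(4) cC(3)] vw(3) by blast
  with w' have Fc: "{G \<in> P. F \<subseteq> G \<and> G \<subseteq> c} \<subseteq> {F, v, w, c}"
    by blast
  let ?D = "(\<lambda>b. (b, \<nu> b)) ` (B - {v, w})"
  have \<nu>C: "\<nu> b \<in> C" "b \<subseteq> \<nu> b" if "b \<in> B - {v, w}" for b
    using \<nu> that unfolding matching_def multiples_def by blast+
  note itv = disjoint_matching_intervals[OF \<nu> Diff_subset]
  show ?thesis
  proof (rule sdepth_geI[OF P_def, where D = "insert (F, c) ?D"])
    show "P \<noteq> {}"
      using assms by blast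
    show "u \<in> P \<and> v' \<in> P \<and> u \<subseteq> v' \<and> card F + 2 \<le> card v'" if uv: "(u, v') \<in> insert (F, c) ?D" for u v'
    proof -
      consider "u = F" "v' = c" | "u \<in> B - {v, w}" "v' = \<nu> u"
        using uv by blast
      then show ?thesis
      proof cases
        case 1
        then show ?thesis
          using assms cC vwB(3) by (auto simp: C_def)
      next
        case 2
        then show ?thesis
          using \<nu>C[of u] by (auto simp: B_def C_def)
      qed
    qed
    show "\<exists>(u, v') \<in> insert (F, c) ?D. u \<subseteq> G \<and> G \<subseteq> v'" if "G \<in> P" "card G < card F + 2" for G
    proof (cases "G \<in> {F, v, w}")
      case True
      then show ?thesis
        using vwB cC by auto
    next
      case False
      then have "G \<in> B - {v, w}"
        using degree_cases[OF that] by auto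
      then show ?thesis
        using \<nu>C(2) by blast
    qed
    have apart: "{F, v, w, c} \<inter> {b, \<nu> b} = {}" if "b \<in> B - {v, w}" for b
    proof -
      have "card b = card F + 1" "card (\<nu> b) = card F + 2" "card v = card F + 1" "card w = card F + 1" "card c = card F + 2"
        using that \<nu>C(1)[OF that] vwB cC by (auto simp: B_def C_def)
      moreover have "\<nu> b \<noteq> c"
        using that \<nu>c by blast
      ultimately show ?thesis
        using that by auto
    qed
    have sep: "{G \<in> P. F \<subseteq> G \<and> G \<subseteq> c} \<inter> {G \<in> P. b \<subseteq> G \<and> G \<subseteq> \<nu> b} = {}"
      if "b \<in> B - {v, w}" for b
      unfolding itv(2)[OF that] by (rule Int_emptyI) (use Fc apart[OF that] in \<open>meson disjoint_iff subsetD\<close>)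
    define itv' where "itv' = (\<lambda>(u, v). {G \<in> P. u \<subseteq> G \<and> G \<subseteq> v})"
    have "itv' (F, c) \<inter> (\<Union>p\<in>?D. itv' p) = {}"
    proof (rule Int_emptyI)
      fix G assume G: "G \<in> itv' (F, c)" "G \<in> (\<Union>p\<in>?D. itv' p)"
      from G(2) obtain b where "b \<in> B - {v, w}" "G \<in> itv' (b, \<nu> b)"
        by blast
      with G(1) sep[of b] show False
        unfolding itv'_def prod.case by (meson disjoint_iff)
    qed
    moreover have "(F, c) \<notin> ?D"
      by (auto simp: B_def)
    ultimately show "disjoint_family_on (\<lambda>(u, v). {G \<in> P. u \<subseteq> G \<and> G \<subseteq> v}) (insert (F, c) ?D)"
      using itv(1) unfolding itv'_def[symmetric] by (simp only: disjoint_family_on_insert simp_thms)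
  qed
qed

end

section \<open>The depth bound\<close>

theorem mainTheorem1:
  fixes I J E :: "('n::finite, 'k::field) mpolynomial set"
    and f :: "('n, 'k) mpolynomial"
    and d s q :: nat
  assumes "sqfree_monomial_ideal I" and "sqfree_monomial_ideal J" and "J \<subset> I"
    and "d > 0"
    and "f \<in> sqfree_monomials" and "total_deg f = d"
    and "E \<subseteq> sqfree_monomials" and "\<And>e. e \<in> E \<Longrightarrow> total_deg e \<ge> d + 1"
    and "minimally_generates (insert f E) I"
    and "s = card {u \<in> sqfree_poset I J. total_deg u = d + 1}"
    and "q = card {u \<in> sqfree_poset I J. total_deg u = d + 2}"
    and "s \<noteq> q + 1"
    and "sdepth I J = d + 1"
  shows "depth I J \<le> enat (d + 1)"
proof (rule ccontr)
  assume "\<not> ?thesis"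
  then obtain ys where ys: "set ys \<subseteq> max_graded_ideal" "regular_seq I J ys" "d + 1 < length ys"
    unfolding depth_def SUP_le_iff by (auto simp: not_le)
  obtain F where f: "f = sqmono F"
    using assms(5) by (auto simp: sqfree_monomials_eq)
  have cF: "card F = d"
    using assms(6) by (simp add: f)
  have gen: "ideal_gen (insert f E) = I"
    using assms(9) by (simp add: minimally_generates_def)
  interpret deep_quotient I J F ys
  proof
    show "sqmono F \<in> I"
      unfolding gen[symmetric] f ideal_gen_def by (intro ideal.span_base) simp
    show "card F < card G" if "sqmono G \<in> I" "G \<noteq> F" for G
    proof -
      have "sqmono G \<in> ideal_gen (insert f E)"
        using that(1) gen by simp
      moreover have "Poly_Mapping.lookup (sqmono G :: ('n, 'k) mpolynomial) (expo G) \<noteq> 0"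
        by (simp add: sqmono_def)
      ultimately obtain H where H: "sqmono H \<in> insert f E" "H \<subseteq> G"
        using coeff_mem_monomial_ideal[of "insert f E" "sqmono G" G] assms(5,7) by auto
      show ?thesis
      proof (cases "H = F")
        case True
        then show ?thesis
          using H(2) that(2) by (intro psubset_card_mono) auto
      next
        case False
        then have "d + 1 \<le> card H"
          using H(1) assms(8)[of "sqmono H"] by (simp add: f)
        then show ?thesis
          using card_mono[of G H] H(2) cF by simp
      qed
    qed
  qed (use assms ys cF in auto)
  have "P \<noteq> {}"
  proof -
    obtain G where G: "G \<subseteq> sqfree_monomials" "I = ideal_gen G"
      using assms(1) unfolding sqfree_monomial_ideal_def by blast
    have "\<not> G \<subseteq> J"
    proof
      assume "G \<subseteq> J"
      then have "I \<subseteq> J"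
        unfolding G(2) ideal_gen_def
        by (rule ideal.span_minimal) (rule sqfree_monomial_ideal_subspace[OF assms(2)])
      then show False
        using assms(3) by blast
    qed
    then obtain g where "g \<in> G" "g \<notin> J"
      by blast
    moreover have "g \<in> I"
      unfolding G(2) ideal_gen_def by (intro ideal.span_base \<open>g \<in> G\<close>)
    ultimately show ?thesis
      using G(1) by (auto simp: P_def sqfree_monomials_eq)
  qed
  then have "d + 2 \<le> sdepth I J"
    using sdepth_ge_if_F_in sdepth_ge_if_F_notin cF by (cases "F \<in> P") auto
  then show False
    using assms(13) by simp
qed

end
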